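(* Let $X$ be an absolutely continuous nonnegative random variable whose CDF $F$ satisfies $F(t)>0$ for all $t>0$, and let $\{X_n,n\ge 1\}$ be the sequence of random variables built from $X_1\stackrel{D}{=}X$ with CDFs $F_1=F$, $F_{n+1}=F_n(1+T_n)$, where $T_n=-\log F_n$. Then for all $n=1,2,\ldots$, $$\mathcal{CE}(X_{n+1})=\mathbb E[\tilde\mu_{n+1}(X_n)]-\mathbb E[\tilde\mu_{n+1}'(Z)]\;\mathcal{CE}(X_n),$$ where the derivative $\tilde\mu_{n+1}'$ can be obtained from $\tilde\mu_{n+1}'(t)=1-\tau_{n+1}(t)\tilde\mu_{n+1}(t)$, and $Z$ is an absolutely continuous nonnegative random variable having PDF $$f_Z(z)=\frac{F_{n+1}(z)-F_n(z)}{\mathbb E(X_n)-\mathbb E(X_{n+1})}=\frac{F_n(z)T_n(z)}{\mathcal{CE}(X_n)},\qquad z>0.$$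
   Context: The sequence is defined by $X_1\stackrel{D}{=}X$ and $[X_{n+1}\,|\,X_n=t]\stackrel{D}{=}[X_n\,|\,X_n\le t]$ for $t>0$, $n\ge1$; the CDFs then satisfy the stated recursion on $(0,\infty)$, and the PDFs satisfy $f_1=f$ (the PDF of $X$), $f_{n+1}=T_nf_n$. Notation: $\tau_n=f_n/F_n$ (reversed hazard rate); $\tilde\mu_n(t)=\mathbb E[t-X_n\,|\,X_n\le t]=\frac{1}{F_n(t)}\int_0^tF_n(x)\,{\rm d}x$, $t>0$ (mean inactivity time); $\mathcal{CE}(X_n)=-\int_0^\infty F_n(x)\log F_n(x)\,{\rm d}x$ (cumulative entropy). *)

theory Defs
  imports "HOL-Probability.Probability"
begin

definition rv_cdf :: "'a measure \<Rightarrow> ('a \<Rightarrow> real) \<Rightarrow> real \<Rightarrow> real" where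
  "rv_cdf M X = cdf (distr M borel X)"

definition neg_log_cdf :: "'a measure \<Rightarrow> ('a \<Rightarrow> real) \<Rightarrow> real \<Rightarrow> real" where
  "neg_log_cdf M X t = - ln (rv_cdf M X t)"

(* E[t - X | X \<le> t], as an expectation under the conditional probability measure
   given the event X \<le> t. When that event has probability 0 this measure is the
   null measure and the value is 0. *)
definition mean_inactivity_time :: "'a measure \<Rightarrow> ('a \<Rightarrow> real) \<Rightarrow> real \<Rightarrow> real" where
  "mean_inactivity_time M X t =
     (\<integral>\<omega>. t - X \<omega> \<partial>uniform_measure M {\<omega> \<in> space M. X \<omega> \<le> t})"

definition reversed_hazard_rate :: "(real \<Rightarrow> real) \<Rightarrow> (real \<Rightarrow> real) \<Rightarrow> real \<Rightarrow> real" where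
  "reversed_hazard_rate f F t = f t / F t"

(* Since ln 0 = 0, the convention 0 log 0 = 0 is built in. *)
definition cumulative_entropy_integrand :: "'a measure \<Rightarrow> ('a \<Rightarrow> real) \<Rightarrow> real \<Rightarrow> real" where
  "cumulative_entropy_integrand M X x = rv_cdf M X x * ln (rv_cdf M X x)"

definition cumulative_entropy :: "'a measure \<Rightarrow> ('a \<Rightarrow> real) \<Rightarrow> real" where
  "cumulative_entropy M X = - (LINT x:{0<..}|lborel. cumulative_entropy_integrand M X x)"

(* The density (F_Y - F_X) / (E X - E Y) on the positive half-line, for variables with
   F_X \<le> F_Y and distinct finite means. *)
definition cdf_gap_density ::
    "'a measure \<Rightarrow> ('a \<Rightarrow> real) \<Rightarrow> ('a \<Rightarrow> real) \<Rightarrow> real \<Rightarrow> real" where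
  "cdf_gap_density M X Y z =
     (if 0 < z
      then (rv_cdf M Y z - rv_cdf M X z) / ((\<integral>\<omega>. X \<omega> \<partial>M) - (\<integral>\<omega>. Y \<omega> \<partial>M))
      else 0)"

end

theory Submission
  imports Defs
begin

text \<open>
  Write \<open>F = F\<^sub>n\<close>, \<open>T = - ln F\<close>, \<open>G = F\<^sub>n\<^sub>+\<^sub>1 = F (1 + T)\<close>, \<open>H t = \<integral>\<^sub>0\<^sup>t G\<close>, so that \<open>\<mu> = H / G\<close> and
  \<open>G' = T f\<^sub>n\<close>. Since \<open>F\<close> is continuous, \<open>F(X\<^sub>n)\<close> is uniform, and Tonelli's theorem gives
  \<open>E[W(F(X\<^sub>n)) H(X\<^sub>n)] = \<integral> G x V(F x) dx\<close> over the positive half-line with \<open>V a = \<integral>\<^sub>a\<^sup>1 W\<close>.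
  For \<open>W u = 1 / (u (1 - ln u))\<close> this is \<open>E[\<mu>(X\<^sub>n)] = \<integral> G ln (1 + T)\<close>; for
  \<open>W u = (ln u)\<^sup>2 / (u (1 - ln u)\<^sup>2)\<close> it evaluates \<open>\<integral> \<tau> \<mu> (G - F)\<close>, whence
  \<open>\<integral> \<mu>' (G - F) = 2 \<integral> G ln (1 + T) - \<integral> G T\<close>. The difference of the two is
  \<open>\<integral> G (T - ln (1 + T)) = - \<integral> G ln G\<close>. That \<open>\<mu>\<close> is differentiable almost everywhere is Lebesgue's
  differentiation theorem, here deduced from the Vitali covering theorem.
\<close>

subsection \<open>Lebesgue differentiation on the line\<close>

text \<open>Outer regularity places \<open>A\<close> in an open \<open>U\<close> with
  \<open>\<mu> U < e * \<eta>\<close>. Arbitrarily small balls inside \<open>U\<close> on which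
  \<open>\<mu>\<close> exceeds \<open>e\<close> times Lebesgue measure surround every bad point in
  \<open>B\<close>. Vitali extracts disjoint ones covering almost all of \<open>B\<close>; their
  total volume is at most \<open>\<mu> U / e\<close>, hence at most \<open>\<eta>\<close>. So
  \<open>B\<close> is negligible.\<close>

lemma AE_small_cballs_of_null_set:
  fixes \<mu> :: "'a::euclidean_space measure"
  assumes "finite_measure \<mu>" and sets: "sets \<mu> = sets borel"
    and A: "A \<in> sets borel" "emeasure \<mu> A = 0" and "0 < e"
  shows "AE x in lborel. x \<in> A \<longrightarrow>
    (\<exists>d>0. \<forall>r. 0 < r \<and> r < d \<longrightarrow> measure \<mu> (cball x r) \<le> e * measure lborel (cball x r))"
proof -
  interpret \<mu>: finite_measure \<mu> by fact
  define B where "B = {x\<in>A. \<forall>d>0. \<exists>r. 0 < r \<and> r < d \<and>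
    e * measure lborel (cball x r) < measure \<mu> (cball x r)}"
  have "negligible B"
    unfolding negligible_outer_le
  proof (intro allI impI)
    fix \<eta> :: real assume "0 < \<eta>"
    have "(INF U \<in> {U. A \<subseteq> U \<and> open U}. emeasure \<mu> U) < ennreal (e * \<eta>)"
      using outer_regular[OF sets _ A(1)] A(2) \<open>0 < \<eta>\<close> \<open>0 < e\<close>
      by (simp add: \<mu>.emeasure_eq_measure)
    then obtain U where U: "A \<subseteq> U" "open U" "emeasure \<mu> U < ennreal (e * \<eta>)"
      by (auto simp: INF_less_iff)
    have \<mu>U: "measure \<mu> U < e * \<eta>"
      using U(3) \<open>0 < e\<close> \<open>0 < \<eta>\<close> by (simp add: \<mu>.emeasure_eq_measure ennreal_less_iff)
    define K where "K = {p. cball (fst p) (snd p) \<subseteq> U \<and> 0 < snd p \<and>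
      e * measure lborel (cball (fst p) (snd p)) < measure \<mu> (cball (fst p) (snd p))}"
    obtain C where C: "countable C" "C \<subseteq> K"
      "pairwise (\<lambda>i j. disjnt (cball (fst i) (snd i)) (cball (fst j) (snd j))) C"
      "negligible (B - (\<Union>i\<in>C. cball (fst i) (snd i)))"
    proof (rule Vitali_covering_theorem_cballs[of K snd B fst])
      show "\<And>i. i \<in> K \<Longrightarrow> 0 < snd i" by (simp add: K_def)
    next
      fix x and d :: real assume x: "x \<in> B" and "0 < d"
      then have "x \<in> U" using U by (auto simp: B_def)
      then obtain k where k: "0 < k" "cball x k \<subseteq> U"
        using \<open>open U\<close> by (auto simp: open_contains_cball)
      then obtain r where r: "0 < r" "r < min d k"
          "e * measure lborel (cball x r) < measure \<mu> (cball x r)"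
        using x \<open>0 < d\<close> unfolding B_def by (smt (verit) mem_Collect_eq)
      then have "(x, r) \<in> K"
        using k subset_cball[of r k x] by (auto simp: K_def)
      with r show "\<exists>i. i \<in> K \<and> x \<in> cball (fst i) (snd i) \<and> snd i < d"
        by (intro exI[of _ "(x, r)"]) auto
    qed
    define V where "V = (\<Union>i\<in>C. cball (fst i) (snd i))"
    have VU: "V \<subseteq> U" using C(2) by (auto simp: V_def K_def)
    have V[measurable]: "V \<in> sets borel"
      unfolding V_def using C(1) by (intro sets.countable_UN'') auto
    have disj: "disjoint_family_on (\<lambda>i. cball (fst i) (snd i)) C"
      using C(3) by (auto simp: disjoint_family_on_def pairwise_def disjnt_def)
    have "ennreal e * emeasure lborel V =
        (\<integral>\<^sup>+i. ennreal e * emeasure lborel (cball (fst i) (snd i)) \<partial>count_space C)"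
      unfolding V_def using disj C(1)
      by (subst emeasure_UN_countable) (auto simp: nn_integral_cmult)
    also have "\<dots> \<le> (\<integral>\<^sup>+i. emeasure \<mu> (cball (fst i) (snd i)) \<partial>count_space C)"
    proof (intro nn_integral_mono)
      fix i assume "i \<in> space (count_space C)"
      then have "e * measure lborel (cball (fst i) (snd i)) < measure \<mu> (cball (fst i) (snd i))"
        using C(2) by (auto simp: K_def)
      moreover have "emeasure lborel (cball (fst i) (snd i)) = measure lborel (cball (fst i) (snd i))"
        using emeasure_lborel_cball_finite[of "fst i" "snd i"] by (intro emeasure_eq_ennreal_measure) auto
      ultimately show "ennreal e * emeasure lborel (cball (fst i) (snd i)) \<le> emeasure \<mu> (cball (fst i) (snd i))"
        using \<open>0 < e\<close> by (simp add: \<mu>.emeasure_eq_measure ennreal_mult'[symmetric] del: content_cball)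
    qed
    also have "\<dots> = emeasure \<mu> V"
      unfolding V_def using disj C(1) by (subst emeasure_UN_countable) (auto simp: sets)
    also have "\<dots> \<le> emeasure \<mu> U"
      using VU U(2) by (intro emeasure_mono) (auto simp: sets)
    also have "\<dots> \<le> ennreal e * ennreal \<eta>"
      using \<mu>U \<open>0 < e\<close> \<open>0 < \<eta>\<close> by (simp add: \<mu>.emeasure_eq_measure ennreal_mult'[symmetric])
    finally have "emeasure lborel V \<le> ennreal \<eta>"
      using \<open>0 < e\<close> by (simp add: ennreal_mult_le_mult_iff)
    then have V_fin: "V \<in> fmeasurable lborel" "measure lborel V \<le> \<eta>"
      using \<open>0 < \<eta>\<close> by (auto simp: fmeasurable_def le_less_trans measure_def enn2real_leI)
    \<comment> \<open>The part of \<open>B\<close> missed by the balls is a Lebesgue null set that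
      need not be Borel, so the covering estimate is finished in \<open>lebesgue\<close>.\<close>
    define R where "R = B - V"
    have R: "R \<in> null_sets lebesgue"
      using C(4) by (simp add: V_def R_def negligible_iff_null_sets)
    have VL: "V \<in> lmeasurable" "measure lebesgue V \<le> \<eta>"
      using V_fin by (auto simp: fmeasurable_def sets_completionI_sets)
    show "\<exists>T. B \<subseteq> T \<and> T \<in> lmeasurable \<and> measure lebesgue T \<le> \<eta>"
    proof (intro exI conjI)
      show "B \<subseteq> V \<union> R" by (auto simp: R_def)
      show "V \<union> R \<in> lmeasurable"
        using R VL by (intro fmeasurable.Un) (auto simp: fmeasurable_def null_setsD1 null_setsD2)
      show "measure lebesgue (V \<union> R) \<le> \<eta>"
        using measure_Un_null_set[of V lebesgue R] R VL by (auto simp: fmeasurableD)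
    qed
  qed
  then have "AE x in lebesgue. x \<notin> B"
    by (intro AE_not_in) (simp add: negligible_iff_null_sets)
  then have "AE x in lborel. x \<notin> B"
    by (simp add: AE_completion_iff)
  then show ?thesis
  proof eventually_elim
    case (elim x)
    show ?case
    proof
      assume "x \<in> A"
      with elim have "\<exists>d>0. \<forall>r. 0 < r \<and> r < d \<longrightarrow> \<not> e * measure lborel (cball x r) < measure \<mu> (cball x r)"
        unfolding B_def by blast
      then show "\<exists>d>0. \<forall>r. 0 < r \<and> r < d \<longrightarrow> measure \<mu> (cball x r) \<le> e * measure lborel (cball x r)"
        by (simp only: not_less)
    qed
  qed
qed

text \<open>
  Continuity makes the sets \<open>E i j\<close> of the Cauchy criterion for difference quotients closed; off
  the differentiability set \<open>deriv f\<close> is a fixed junk value.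
\<close>

lemma borel_measurable_deriv:
  fixes f :: "real \<Rightarrow> real"
  assumes cont: "continuous_on UNIV f"
  shows "deriv f \<in> borel_measurable borel"
proof -
  define q where "q h x = (f (x + h) - f x) / h" for h x
  have q_cont: "continuous_on UNIV (q h)" for h
  proof -
    have "continuous_on UNIV (\<lambda>x. f (x + h))"
      by (rule continuous_on_compose2[OF cont]) (auto intro!: continuous_intros)
    moreover have "q h = (\<lambda>x. (f (x + h) - f x) * inverse h)"
      by (auto simp: q_def fun_eq_iff divide_inverse)
    ultimately show ?thesis
      by (auto intro!: continuous_intros cont)
  qed
  define I where "I i = inverse (real (Suc i))" for i
  define E where "E i j = {x. \<forall>h k. h \<noteq> 0 \<and> \<bar>h\<bar> < I j \<and> k \<noteq> 0 \<and> \<bar>k\<bar> < I j \<longrightarrow> \<bar>q h x - q k x\<bar> \<le> I i}" for i j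
  \<comment> \<open>By the Cauchy criterion this is the set of differentiability. Tolerances and
    radii run through the countable family \<open>I\<close>, so it is a countable intersection of
    countable unions of closed sets.\<close>
  define D where "D = (\<Inter>i. \<Union>j. E i j)"
  have "closed (E i j)" for i j
  proof -
    have "E i j = (\<Inter>h\<in>{h. h \<noteq> 0 \<and> \<bar>h\<bar> < I j}. \<Inter>k\<in>{k. k \<noteq> 0 \<and> \<bar>k\<bar> < I j}. {x. \<bar>q h x - q k x\<bar> \<le> I i})"
      by (auto simp: E_def)
    also have "closed \<dots>"
      by (intro closed_INT ballI closed_Collect_le continuous_intros q_cont)
    finally show ?thesis .
  qed
  then have [measurable]: "E i j \<in> sets borel" for i j by (rule borel_closed)
  have D_meas[measurable]: "D \<in> sets borel" unfolding D_def by measurable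
  have deriv_iff: "(f has_field_derivative l) (at x) \<longleftrightarrow> ((\<lambda>h. q h x) \<longlongrightarrow> l) (at 0)" for l x
    by (simp add: DERIV_def q_def)
  have inD: "x \<in> D \<longleftrightarrow> (\<exists>l. (f has_field_derivative l) (at x))" for x
  proof
    assume "\<exists>l. (f has_field_derivative l) (at x)"
    then obtain l where l: "((\<lambda>h. q h x) \<longlongrightarrow> l) (at 0)" by (auto simp: deriv_iff)
    have "\<exists>j. x \<in> E i j" for i
    proof -
      have "0 < I i / 2" by (simp add: I_def)
      then obtain d where d: "0 < d" "\<And>h. h \<noteq> 0 \<Longrightarrow> \<bar>h\<bar> < d \<Longrightarrow> \<bar>q h x - l\<bar> < I i / 2"
        using LIM_D[OF l, of "I i / 2"] by (auto simp del: less_divide_eq_numeral1)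
      obtain j where j: "I j < d" using reals_Archimedean d(1) unfolding I_def by blast
      have "x \<in> E i j"
        unfolding E_def
      proof (clarify)
        fix h k assume "h \<noteq> 0" "\<bar>h\<bar> < I j" "k \<noteq> 0" "\<bar>k\<bar> < I j"
        then have "\<bar>q h x - l\<bar> < I i / 2" "\<bar>q k x - l\<bar> < I i / 2" using d j by auto
        then show "\<bar>q h x - q k x\<bar> \<le> I i" by linarith
      qed
      then show ?thesis ..
    qed
    then show "x \<in> D" by (auto simp: D_def)
  next
    assume x: "x \<in> D"
    have "convergent_filter (filtermap (\<lambda>h. q h x) (at 0))"
      if "cauchy_filter (filtermap (\<lambda>h. q h x) (at 0))"
      using that by (intro cauchy_filter_convergent)  (auto simp: filtermap_bot_iff)
    moreover have "cauchy_filter (filtermap (\<lambda>h. q h x) (at 0))"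
      unfolding cauchy_filter_metric_filtermap
    proof (intro allI impI)
      fix e :: real assume "0 < e"
      then obtain i where i: "I i < e" using reals_Archimedean unfolding I_def by blast
      obtain j where j: "x \<in> E i j" using x by (auto simp: D_def)
      have "0 < I j" by (simp add: I_def)
      then have "eventually (\<lambda>h. h \<noteq> 0 \<and> \<bar>h\<bar> < I j) (at 0)"
        by (auto simp: eventually_at dist_real_def)
      moreover have "dist (q h x) (q k x) < e"
        if "h \<noteq> 0 \<and> \<bar>h\<bar> < I j" "k \<noteq> 0 \<and> \<bar>k\<bar> < I j" for h k
        using j that i unfolding E_def dist_real_def by fastforce
      ultimately show "\<exists>P. eventually P (at 0) \<and> (\<forall>h k. P h \<and> P k \<longrightarrow> dist (q h x) (q k x) < e)"
        by blast
    qed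
    ultimately show "\<exists>l. (f has_field_derivative l) (at x)"
      by (auto simp: deriv_iff convergent_filter_iff filterlim_def)
  qed
  define c where "c = (SOME D::real. False)"
  \<comment> \<open>On \<open>D\<close> the derivative is the limit along the null sequence
    \<open>I n\<close>, hence a limit of measurable functions of \<open>x\<close>.\<close>
  have "deriv f x = (if x \<in> D then lim (\<lambda>n. q (I n) x) else c)" for x
  proof (cases "x \<in> D")
    case True
    then obtain l where l: "(f has_field_derivative l) (at x)" using inD by auto
    have "filterlim I (at 0) sequentially"
      unfolding filterlim_at using LIMSEQ_inverse_real_of_nat
      by (auto simp: I_def[abs_def])
    then have "(\<lambda>n. q (I n) x) \<longlonglongrightarrow> l"
      using l unfolding deriv_iff by (rule filterlim_compose[rotated])
    then show ?thesis using True l by (simp add: limI DERIV_imp_deriv)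
  next
    case False
    then have "(\<lambda>D. (f has_field_derivative D) (at x)) = (\<lambda>D. False)" using inD by auto
    then show ?thesis using False by (simp add: deriv_def c_def)
  qed
  then have "deriv f = (\<lambda>x. if x \<in> D then lim (\<lambda>n. q (I n) x) else c)" by (rule ext)
  moreover have [measurable]: "q h \<in> borel_measurable borel" for h
    using q_cont by (rule borel_measurable_continuous_onI)
  ultimately show ?thesis by simp
qed


text \<open>
  On \<open>{f \<le> q}\<close> the truncation \<open>max 0 (f - q)\<close> is the density of a measure that vanishes there, so
  it contributes nothing to the upper derivative, which is therefore at most \<open>q\<close>.
\<close>

lemma integral_upper_derivative_AE:
  fixes f :: "real \<Rightarrow> real"
  assumes f: "integrable lborel f"
  shows "AE x in lborel. \<forall>e>0. \<forall>\<^sub>F y in at x.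
    ((LBINT t:{..y}. f t) - (LBINT t:{..x}. f t)) / (y - x) \<le> f x + e"
proof -
  have [measurable]: "f \<in> borel_measurable borel" using f by auto
  define F where "F x = (LBINT t:{..x}. f t)" for x
  have f_on: "set_integrable lborel A f" if "A \<in> sets borel" for A
    unfolding set_integrable_def using integrable_mult_indicator[OF _ f, of A] that by simp
  have F_diff: "F y - F x = (LBINT t:{x<..y}. f t)" if "x \<le> y" for x y
  proof -
    have "F y = F x + (LBINT t:{x<..y}. f t)"
      unfolding F_def using that
      by (subst set_integral_Un[symmetric]) (auto simp: f_on ivl_disj_un)
    then show ?thesis by simp
  qed
  \<comment> \<open>The bounded window secures integrability: for negative \<open>q\<close> the
    truncation \<open>max 0 (f t - q)\<close> is not integrable over the whole line.\<close>
  define g where "g q N t = max 0 (f t - q) * indicator {-real N..real N} t" for q N t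
  have g_int: "integrable lborel (g q N)" for q N
  proof (rule Bochner_Integration.integrable_bound)
    show "integrable lborel (\<lambda>t. \<bar>f t\<bar> + \<bar>q\<bar> * indicator {-real N..real N} t)"
      using f by auto
    show "AE t in lborel. norm (g q N t) \<le> norm (\<bar>f t\<bar> + \<bar>q\<bar> * indicator {-real N..real N} t)"
      by (auto simp: g_def indicator_def)
  qed (simp add: g_def[abs_def])
  have g_nonneg: "0 \<le> g q N t" for q N t by (auto simp: g_def)
  define \<mu> where "\<mu> q N = density lborel (\<lambda>t. ennreal (g q N t))" for q N
  have \<mu>_eq: "emeasure (\<mu> q N) A = (LBINT t:A. g q N t)" if "A \<in> sets borel" for A q N
  proof -
    have "emeasure (\<mu> q N) A = (\<integral>\<^sup>+t. ennreal (g q N t * indicator A t) \<partial>lborel)"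
      unfolding \<mu>_def using that g_int[of q N]
      by (subst emeasure_density) (auto intro!: nn_integral_cong simp: indicator_def)
    also have "\<dots> = (LBINT t:A. g q N t)"
      using integrable_mult_indicator[OF _ g_int, of A q N] that g_nonneg
      by (subst nn_integral_eq_integral) (auto simp: set_lebesgue_integral_def mult.commute)
    finally show ?thesis .
  qed
  have \<mu>_fin: "finite_measure (\<mu> q N)" for q N
    by (rule finite_measureI) (use \<mu>_eq[of UNIV q N] in \<open>simp add: \<mu>_def\<close>)
  \<comment> \<open>Rational \<open>q\<close> and natural \<open>N\<close>, \<open>k\<close> leave
    only countably many exceptional null sets.\<close>
  have "AE x in lborel. \<forall>q\<in>\<rat>. \<forall>N k. f x \<le> q \<longrightarrow> (\<exists>d>0. \<forall>r. 0 < r \<and> r < d \<longrightarrow>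
      measure (\<mu> q N) (cball x r) \<le> inverse (real (Suc k)) * measure lborel (cball x r))"
  proof (intro AE_ball_countable[THEN iffD2] countable_rat ballI AE_all_countable[THEN iffD2] allI)
    fix q :: real and N k
    have "emeasure (\<mu> q N) {x. f x \<le> q} =
        (\<integral>\<^sup>+t. ennreal (g q N t) * indicator {x. f x \<le> q} t \<partial>lborel)"
      unfolding \<mu>_def using g_int[of q N] by (subst emeasure_density) simp_all
    also have "\<dots> = (\<integral>\<^sup>+(t::real). 0 \<partial>lborel)"
      by (intro nn_integral_cong) (auto simp: g_def indicator_def)
    finally have "emeasure (\<mu> q N) {x. f x \<le> q} = 0" by simp
    then show "AE x in lborel. f x \<le> q \<longrightarrow> (\<exists>d>0. \<forall>r. 0 < r \<and> r < d \<longrightarrow>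
      measure (\<mu> q N) (cball x r) \<le> inverse (real (Suc k)) * measure lborel (cball x r))"
      using AE_small_cballs_of_null_set[OF \<mu>_fin, of q N "{x. f x \<le> q}" "inverse (real (Suc k))"]
      by (simp add: \<mu>_def)
  qed
  then show ?thesis
    unfolding F_def[symmetric]
  proof eventually_elim
    fix x assume x: "\<forall>q\<in>\<rat>. \<forall>N k. f x \<le> q \<longrightarrow> (\<exists>d>0. \<forall>r. 0 < r \<and> r < d \<longrightarrow>
      measure (\<mu> q N) (cball x r) \<le> inverse (real (Suc k)) * measure lborel (cball x r))"
    show "\<forall>e>0. \<forall>\<^sub>F y in at x. (F y - F x) / (y - x) \<le> f x + e"
    proof (intro allI impI)
      fix e :: real assume "0 < e"
      obtain q where q: "q \<in> \<rat>" "f x < q" "q < f x + e / 2"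
        using Rats_dense_in_real[of "f x" "f x + e / 2"] \<open>0 < e\<close> by auto
      obtain N where N: "\<bar>x\<bar> + 1 \<le> real N" using real_arch_simple by blast
      obtain k where k: "inverse (real (Suc k)) < e / 4"
        using reals_Archimedean[of "e / 4"] \<open>0 < e\<close> by auto
      obtain d where d: "0 < d" "\<And>r. 0 < r \<Longrightarrow> r < d \<Longrightarrow>
          measure (\<mu> q N) (cball x r) \<le> inverse (real (Suc k)) * measure lborel (cball x r)"
        using x q(1,2) less_imp_le by metis
      \<comment> \<open>Allowing \<open>x\<close> to be either endpoint treats both one-sided
        quotients at once. The error \<open>e\<close> is split in half: \<open>q\<close> exceeds
        \<open>f x\<close> by less than \<open>e / 2\<close>, and a ball of radius \<open>r\<close>
        has length \<open>2 * r\<close>, so the excess \<open>g\<close> costs at most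
        \<open>e / 4 * (2 * r)\<close>.\<close>
      have *: "(LBINT t:{a<..b}. f t) \<le> (f x + e) * (b - a)"
        if ab: "a < b" "a = x \<or> b = x" "b - a < min d 1" for a b
      proof -
        define r where "r = b - a"
        have r: "0 < r" "r < d" using ab by (auto simp: r_def)
        have sub: "{a<..b} \<subseteq> cball x r" "{a<..b} \<subseteq> {-real N..real N}"
          using ab N by (auto simp: r_def dist_real_def)
        have g_on: "set_integrable lborel A (g q N)" if "A \<in> sets borel" for A
          unfolding set_integrable_def using integrable_mult_indicator[OF _ g_int, of A q N] that by simp
        have const: "set_integrable lborel {a<..b} (\<lambda>_. q)"
          unfolding set_integrable_def using ab
          by (intro integrable_scaleR_left integrable_real_indicator) auto
        have "(LBINT t:{a<..b}. f t) \<le> (LBINT t:{a<..b}. q + g q N t)"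
          using sub(2) by (intro set_integral_mono f_on set_integral_add g_on const)
            (auto simp: g_def indicator_def)
        also have "\<dots> = q * r + (LBINT t:{a<..b}. g q N t)"
          using ab by (subst set_integral_add)
            (auto simp: g_on const r_def set_lebesgue_integral_def)
        also have "(LBINT t:{a<..b}. g q N t) \<le> measure (\<mu> q N) (cball x r)"
        proof -
          have "ennreal (LBINT t:{a<..b}. g q N t) \<le> emeasure (\<mu> q N) (cball x r)"
            using sub(1) by (subst \<mu>_eq[symmetric]) (auto intro!: emeasure_mono simp: \<mu>_def)
          then show ?thesis
            by (subst (asm) finite_measure.emeasure_eq_measure[OF \<mu>_fin]) simp
        qed
        also have "\<dots> \<le> inverse (real (Suc k)) * (2 * r)"
          using d(2)[OF r] r by (simp add: cball_eq_atLeastAtMost)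
        also have "\<dots> \<le> e / 4 * (2 * r)"
          using k r by (intro mult_right_mono) auto
        finally have "(LBINT t:{a<..b}. f t) \<le> (q + e / 2) * r" by (simp add: algebra_simps)
        also have "\<dots> \<le> (f x + e) * r"
          using q(3) r by (intro mult_right_mono) auto
        finally show ?thesis by (simp add: r_def)
      qed
      have "\<forall>\<^sub>F y in at x. y \<noteq> x \<and> \<bar>y - x\<bar> < min d 1"
        using \<open>0 < d\<close> by (auto simp: eventually_at dist_real_def intro!: exI[of _ "min d 1"])
      then show "\<forall>\<^sub>F y in at x. (F y - F x) / (y - x) \<le> f x + e"
      proof eventually_elim
        fix y assume y: "y \<noteq> x \<and> \<bar>y - x\<bar> < min d 1"
        show "(F y - F x) / (y - x) \<le> f x + e"
        proof (cases "x < y")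
          case True
          then show ?thesis using *[of x y] y F_diff[of x y] by (simp add: divide_le_eq)
        next
          case False
          then have "y < x" using y by simp
          have "(F y - F x) / (y - x) = (F x - F y) / (x - y)"
            by (metis minus_diff_eq minus_divide_divide)
          then show ?thesis using *[of y x] y F_diff[of y x] \<open>y < x\<close>
            by (simp add: divide_le_eq)
        qed
      qed
    qed
  qed
qed

text \<open>The upper bound, applied to \<open>f\<close> and to \<open>- f\<close>, squeezes the
  difference quotient.\<close>

theorem lebesgue_differentiation:
  fixes f :: "real \<Rightarrow> real"
  assumes f: "integrable lborel f"
  shows "AE x in lborel. ((\<lambda>x. LBINT t:{..x}. f t) has_real_derivative f x) (at x)"
proof -
  have neg: "(LBINT t:{..y}. - f t) = - (LBINT t:{..y}. f t)" for y
    by (simp add: set_lebesgue_integral_def)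
  show ?thesis
    using integral_upper_derivative_AE[OF f] integral_upper_derivative_AE[of "\<lambda>x. - f x", OF integrable_minus[OF f]]
  proof eventually_elim
    case (elim x)
    define Q where "Q y = ((LBINT t:{..y}. f t) - (LBINT t:{..x}. f t)) / (y - x)" for y
    have "(Q \<longlongrightarrow> f x) (at x)"
    proof (rule tendstoI)
      fix e :: real assume "0 < e"
      then have "\<forall>\<^sub>F y in at x. Q y \<le> f x + e / 2" "\<forall>\<^sub>F y in at x. - Q y \<le> - f x + e / 2"
        using elim(1)[rule_format, of "e/2"] elim(2)[rule_format, of "e/2"]
        unfolding Q_def neg by (simp_all add: minus_divide_left)
      then show "\<forall>\<^sub>F y in at x. dist (Q y) (f x) < e"
        by eventually_elim (use \<open>0 < e\<close> in \<open>auto simp: dist_real_def abs_less_iff\<close>)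
    qed
    then show ?case unfolding has_field_derivative_iff Q_def .
  qed
qed

subsection \<open>The probability integral transform\<close>

text \<open>The two CDFs are compared. By continuity every level strictly between 0 and 1 is
  attained, so the sublevel sets of \<open>cdf M\<close> can be compared with half-lines whose
  probability is the level itself.\<close>

lemma (in real_distribution) distr_cdf_uniform:
  assumes cont: "continuous_on UNIV (cdf M)"
  shows "distr M borel (cdf M) = uniform_measure lborel {0..1}"
proof (rule cdf_unique)
  have mono: "mono (cdf M)" by (simp add: mono_def cdf_nondecreasing)
  have [measurable]: "cdf M \<in> borel_measurable borel" using mono by (rule borel_measurable_mono)
  have surj: "\<exists>s. cdf M s = v" if v: "0 < v" "v < 1" for v
  proof -
    obtain a where a: "cdf M a < v"
      using order_tendstoD(2)[OF cdf_lim_at_bot v(1)] eventually_happens'[OF trivial_limit_at_bot_linorder] by blast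
    obtain b where b: "v < cdf M b"
      using order_tendstoD(1)[OF cdf_lim_at_top_prob v(2)] eventually_happens'[OF trivial_limit_at_top_linorder] by blast
    have "a \<le> b" using a b cdf_nondecreasing[of b a] by linarith
    then show ?thesis
      using IVT'[of "cdf M" a v b] a b continuous_on_subset[OF cont] by auto
  qed
  have sub_iff: "cdf M x \<le> cdf M s" if "x \<le> s" for x s using that by (rule cdf_nondecreasing)
  show unif: "real_distribution (uniform_measure lborel {0..1::real})"
    by (intro real_distribution.intro real_distribution_axioms.intro prob_space_uniform_measure) auto
  show distr: "real_distribution (distr M borel (cdf M))"
    by (intro real_distribution_distr) simp
  show "cdf (distr M borel (cdf M)) = cdf (uniform_measure lborel {0..1})"
  proof
    fix u :: real
    have L: "cdf (distr M borel (cdf M)) u = prob {x. cdf M x \<le> u}"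
      by (simp add: cdf_def[of "distr M borel (cdf M)"] measure_distr vimage_def)
    consider "u < 0" | "1 \<le> u" | "0 \<le> u" "u < 1" by linarith
    then have "prob {x. cdf M x \<le> u} = max 0 (min 1 u)"
    proof cases
      case 1
      then have "\<not> cdf M x \<le> u" for x using cdf_nonneg[of x] by linarith
      then show ?thesis using 1 by simp
    next
      case 2
      then have "cdf M x \<le> u" for x using cdf_bounded_prob[of x] by linarith
      then show ?thesis using 2 prob_space by simp
    next
      case 3
      \<comment> \<open>Levels \<open>v\<close> above \<open>u\<close> are used because
        \<open>cdf M\<close> may stay at the value \<open>u\<close> beyond any chosen point, and the
        value 0 need not be attained.\<close>
      have "prob {x. cdf M x \<le> u} \<le> v" if v: "u < v" "v < 1" for v
      proof -
        obtain s where s: "cdf M s = v" using surj[of v] v 3 by auto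
        have "{x. cdf M x \<le> u} \<subseteq> {..s}"
        proof
          fix x assume "x \<in> {x. cdf M x \<le> u}"
          then have "\<not> s \<le> x" using s v(1) sub_iff[of s x] by auto
          then show "x \<in> {..s}" by simp
        qed
        then have "prob {x. cdf M x \<le> u} \<le> prob {..s}" by (intro finite_measure_mono) auto
        then show ?thesis using s by (simp add: cdf_def2)
      qed
      then have "prob {x. cdf M x \<le> u} \<le> u"
        using dense_ge_bounded[OF 3(2)] by blast
      moreover have "u \<le> prob {x. cdf M x \<le> u}"
      proof (cases "u = 0")
        case False
        then obtain s where s: "cdf M s = u" using surj[of u] 3 by auto
        have "prob {..s} \<le> prob {x. cdf M x \<le> u}"
          using s sub_iff by (intro finite_measure_mono) auto
        then show ?thesis using s by (simp add: cdf_def2)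
      qed simp
      ultimately show ?thesis using 3 by simp
    qed
    moreover have "cdf (uniform_measure lborel {0..1}) u = max 0 (min 1 u)"
    proof -
      have "{0..1} \<inter> {..u} = {0..min 1 u}" by auto
      then show ?thesis by (simp add: cdf_def measure_uniform_measure) 
    qed
    ultimately show "cdf (distr M borel (cdf M)) u = cdf (uniform_measure lborel {0..1}) u"
      using L by simp
  qed
qed

lemma (in real_distribution) nn_integral_cdf:
  assumes cont: "continuous_on UNIV (cdf M)" and [measurable]: "W \<in> borel_measurable borel"
  shows "(\<integral>\<^sup>+x. W (cdf M x) \<partial>M) = (\<integral>\<^sup>+u. W u * indicator {0..1} u \<partial>lborel)"
proof -
  have [measurable]: "cdf M \<in> borel_measurable borel"
    by (intro borel_measurable_mono) (simp add: mono_def cdf_nondecreasing)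
  have "(\<integral>\<^sup>+x. W (cdf M x) \<partial>M) = (\<integral>\<^sup>+u. W u \<partial>distr M borel (cdf M))"
    by (subst nn_integral_distr) auto
  also have "\<dots> = (\<integral>\<^sup>+u. W u * indicator {0..1} u \<partial>lborel)"
    by (simp add: distr_cdf_uniform[OF cont] nn_integral_uniform_measure divide_ennreal_def)
  finally show ?thesis .
qed

text \<open>The uniform law has no atoms, so a flat stretch of the CDF carries no mass. This stands
  in for strict monotonicity in the next two lemmas.\<close>

lemma (in real_distribution) AE_cdf_neq:
  assumes cont: "continuous_on UNIV (cdf M)"
  shows "AE x in M. cdf M x \<noteq> u"
proof -
  have [measurable]: "cdf M \<in> borel_measurable borel"
    by (intro borel_measurable_mono) (simp add: mono_def cdf_nondecreasing)
  have "AE v in distr M borel (cdf M). v \<noteq> u"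
    unfolding distr_cdf_uniform[OF cont] using AE_lborel_singleton[of u]
    by (intro AE_uniform_measureI) auto
  then show ?thesis by (rule AE_distrD[rotated]) simp
qed

text \<open>Off the null set where \<open>cdf M x = cdf M t\<close>, the condition
  \<open>t < x\<close> is equivalent to \<open>cdf M t \<le> cdf M x\<close>, an event of the
  uniform variable.\<close>

lemma (in real_distribution) nn_integral_cdf_greaterThan:
  assumes cont: "continuous_on UNIV (cdf M)" and [measurable]: "W \<in> borel_measurable borel"
  shows "(\<integral>\<^sup>+x. W (cdf M x) * indicator {t<..} x \<partial>M) =
    (\<integral>\<^sup>+u. W u * indicator {cdf M t..1} u \<partial>lborel)"
proof -
  have "(\<integral>\<^sup>+x. W (cdf M x) * indicator {t<..} x \<partial>M) =
      (\<integral>\<^sup>+x. (\<lambda>u. W u * indicator {cdf M t..} u) (cdf M x) \<partial>M)"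
    using AE_cdf_neq[OF cont, of "cdf M t"]
  proof (intro nn_integral_cong_AE, eventually_elim)
    case (elim x)
    then have "t < x \<longleftrightarrow> cdf M t \<le> cdf M x"
      using cdf_nondecreasing[of x t] cdf_nondecreasing[of t x] by linarith
    then show ?case by (auto split: split_indicator)
  qed
  also have "\<dots> = (\<integral>\<^sup>+u. W u * indicator {cdf M t..1} u \<partial>lborel)"
    using cdf_nonneg[of t]
    by (subst nn_integral_cdf[OF cont]) (auto intro!: nn_integral_cong split: split_indicator)
  finally show ?thesis .
qed

lemma (in real_distribution) nn_integral_cdf_atMost:
  assumes cont: "continuous_on UNIV (cdf M)" and [measurable]: "W \<in> borel_measurable borel"
  shows "(\<integral>\<^sup>+x. W (cdf M x) * indicator {..t} x \<partial>M) =
    (\<integral>\<^sup>+u. W u * indicator {0..cdf M t} u \<partial>lborel)"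
proof -
  have "(\<integral>\<^sup>+x. W (cdf M x) * indicator {..t} x \<partial>M) =
      (\<integral>\<^sup>+x. (\<lambda>u. W u * indicator {..cdf M t} u) (cdf M x) \<partial>M)"
    using AE_cdf_neq[OF cont, of "cdf M t"]
  proof (intro nn_integral_cong_AE, eventually_elim)
    case (elim x)
    then have "x \<le> t \<longleftrightarrow> cdf M x \<le> cdf M t"
      using cdf_nondecreasing[of x t] cdf_nondecreasing[of t x] by linarith
    then show ?case by (auto split: split_indicator)
  qed
  also have "\<dots> = (\<integral>\<^sup>+u. W u * indicator {0..cdf M t} u \<partial>lborel)"
    using cdf_bounded_prob[of t]
    by (subst nn_integral_cdf[OF cont]) (auto intro!: nn_integral_cong split: split_indicator)
  finally show ?thesis .
qed

text \<open>Once the order of integration is exchanged, the inner integral runs over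
  \<open>t > x\<close> and depends on \<open>t\<close> only through the uniform variable
  \<open>cdf M t\<close>.\<close>

lemma (in real_distribution) nn_integral_cdf_Tonelli:
  assumes cont: "continuous_on UNIV (cdf M)"
    and [measurable]: "W \<in> borel_measurable borel" "g \<in> borel_measurable borel"
  shows "(\<integral>\<^sup>+t. W (cdf M t) * (\<integral>\<^sup>+x. g x * indicator {0<..<t} x \<partial>lborel) \<partial>M) =
    (\<integral>\<^sup>+x. g x * (\<integral>\<^sup>+u. W u * indicator {cdf M x..1} u \<partial>lborel) * indicator {0<..} x \<partial>lborel)"
proof -
  interpret pair_sigma_finite M lborel
    by (intro pair_sigma_finite.intro sigma_finite_lborel sigma_finite_measure)
  have [measurable]: "cdf M \<in> borel_measurable borel"
    by (intro borel_measurable_mono) (simp add: mono_def cdf_nondecreasing)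
  have "(\<integral>\<^sup>+t. W (cdf M t) * (\<integral>\<^sup>+x. g x * indicator {0<..<t} x \<partial>lborel) \<partial>M) =
      (\<integral>\<^sup>+t. (\<integral>\<^sup>+x. W (cdf M t) * (g x * of_bool (0 < x \<and> x < t)) \<partial>lborel) \<partial>M)"
    by (subst nn_integral_cmult[symmetric]) (auto intro!: nn_integral_cong simp: indicator_def)
  also have "\<dots> = (\<integral>\<^sup>+x. (\<integral>\<^sup>+t. W (cdf M t) * (g x * of_bool (0 < x \<and> x < t)) \<partial>M) \<partial>lborel)"
    by (intro Fubini'[symmetric]) measurable
  also have "\<dots> = (\<integral>\<^sup>+x. (\<integral>\<^sup>+t. (g x * indicator {0<..} x) * (W (cdf M t) * indicator {x<..} t) \<partial>M) \<partial>lborel)"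
    by (intro nn_integral_cong) (auto simp: indicator_def mult_ac)
  also have "\<dots> = (\<integral>\<^sup>+x. (g x * indicator {0<..} x) * (\<integral>\<^sup>+u. W u * indicator {cdf M x..1} u \<partial>lborel) \<partial>lborel)"
    by (intro nn_integral_cong, subst nn_integral_cmult) (auto simp: nn_integral_cdf_greaterThan[OF cont])
  finally show ?thesis by (simp add: mult_ac)
qed

text \<open>On the conditioning event, \<open>t - X\<close> is the length of \<open>{X..t}\<close>.
  Tonelli turns its expectation into the integral of the CDF over \<open>x \<le> t\<close>, and
  \<open>zero\<close> discards the negative \<open>x\<close>.\<close>

lemma mean_inactivity_time_eq:
  fixes X :: "'a \<Rightarrow> real"
  assumes "prob_space M" and [measurable]: "X \<in> borel_measurable M"
    and zero: "\<And>x. x \<le> 0 \<Longrightarrow> rv_cdf M X x = 0"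
  shows "mean_inactivity_time M X t = (LBINT x:{0..t}. rv_cdf M X x) / rv_cdf M X t"
proof -
  interpret prob_space M by fact
  interpret pair_sigma_finite M lborel
    by (intro pair_sigma_finite.intro sigma_finite_lborel sigma_finite_measure)
  define A where "A = {\<omega> \<in> space M. X \<omega> \<le> t}"
  have [measurable]: "A \<in> sets M" by (simp add: A_def)
  have cdf: "rv_cdf M X x = prob {\<omega> \<in> space M. X \<omega> \<le> x}" for x
    by (simp add: rv_cdf_def cdf_def measure_distr vimage_def Int_def conj_commute)
  have [measurable]: "rv_cdf M X \<in> borel_measurable borel"
    by (intro borel_measurable_mono) (auto simp: mono_def cdf intro!: finite_measure_mono)
  show ?thesis
  proof (cases "prob A = 0")
    \<comment> \<open>Both sides are 0 here: the conditional measure is null, and division by zero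
      gives 0.\<close>
    case True
    then have "AE \<omega> in M. \<omega> \<notin> A" by (intro AE_not_in) (auto simp: null_sets_def emeasure_eq_measure)
    then have "mean_inactivity_time M X t = (\<integral>\<omega>. 0 \<partial>uniform_measure M A)"
      unfolding mean_inactivity_time_def A_def[symmetric] uniform_measure_def
      by (intro integral_cong_AE) (auto simp: AE_density split: split_indicator)
    then show ?thesis using True by (simp add: cdf A_def)
  next
    case False
    have "mean_inactivity_time M X t = (\<integral>\<omega>. (indicator A \<omega> / prob A) * (t - X \<omega>) \<partial>M)"
    proof -
      have "uniform_measure M A = density M (\<lambda>\<omega>. ennreal (indicator A \<omega> / prob A))"
        unfolding uniform_measure_def using False measure_nonneg[of M A]
        by (intro density_cong) (auto simp: emeasure_eq_measure divide_ennreal[symmetric] less_le split: split_indicator)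
      then show ?thesis
        by (simp add: mean_inactivity_time_def integral_density flip: A_def)
    qed
    also have "\<dots> = (\<integral>\<omega>. indicator A \<omega> * (t - X \<omega>) \<partial>M) / prob A"
      by (simp add: field_simps flip: integral_divide_zero)
    also have "(\<integral>\<omega>. indicator A \<omega> * (t - X \<omega>) \<partial>M) = (LBINT x:{0..t}. rv_cdf M X x)"
    proof -
      have "(\<integral>\<^sup>+\<omega>. ennreal (indicator A \<omega> * (t - X \<omega>)) \<partial>M) =
          (\<integral>\<^sup>+\<omega>. (\<integral>\<^sup>+x. of_bool (X \<omega> \<le> x \<and> x \<le> t) \<partial>lborel) \<partial>M)"
      proof (intro nn_integral_cong)
        fix \<omega> assume "\<omega> \<in> space M"
        have "(\<integral>\<^sup>+x. of_bool (X \<omega> \<le> x \<and> x \<le> t) \<partial>lborel) = (\<integral>\<^sup>+x. indicator {X \<omega>..t} x \<partial>lborel)"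
          by (intro nn_integral_cong) (auto simp: indicator_def)
        then show "ennreal (indicator A \<omega> * (t - X \<omega>)) = (\<integral>\<^sup>+x. of_bool (X \<omega> \<le> x \<and> x \<le> t) \<partial>lborel)"
          using \<open>\<omega> \<in> space M\<close> by (auto simp: A_def emeasure_lborel_Icc_eq)
      qed
      also have "\<dots> = (\<integral>\<^sup>+x. (\<integral>\<^sup>+\<omega>. of_bool (X \<omega> \<le> x \<and> x \<le> t) \<partial>M) \<partial>lborel)"
        by (intro Fubini'[symmetric]) measurable
      also have "\<dots> = (\<integral>\<^sup>+x. ennreal (indicator {0..t} x * rv_cdf M X x) \<partial>lborel)"
      proof (intro nn_integral_cong)
        fix x :: real
        have "(\<integral>\<^sup>+\<omega>. of_bool (X \<omega> \<le> x \<and> x \<le> t) \<partial>M) =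
            (\<integral>\<^sup>+\<omega>. indicator {..t} x * indicator {\<omega> \<in> space M. X \<omega> \<le> x} \<omega> \<partial>M)"
          by (intro nn_integral_cong) (auto simp: indicator_def)
        also have "\<dots> = indicator {..t} x * ennreal (rv_cdf M X x)"
          by (subst nn_integral_cmult) (auto simp: cdf emeasure_eq_measure)
        finally show "(\<integral>\<^sup>+\<omega>. of_bool (X \<omega> \<le> x \<and> x \<le> t) \<partial>M) = ennreal (indicator {0..t} x * rv_cdf M X x)"
          using zero[of x] by (auto split: split_indicator)
      qed
      finally have "(\<integral>\<^sup>+\<omega>. ennreal (indicator A \<omega> * (t - X \<omega>)) \<partial>M) =
        (\<integral>\<^sup>+x. ennreal (indicator {0..t} x * rv_cdf M X x) \<partial>lborel)" .
      moreover have "0 \<le> indicator A \<omega> * (t - X \<omega>)" for \<omega> by (auto simp: A_def indicator_def)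
      moreover have "0 \<le> indicator {0..t} x * rv_cdf M X x" for x by (auto simp: cdf indicator_def)
      ultimately show ?thesis
        unfolding set_lebesgue_integral_def
        by (simp add: integral_eq_nn_integral)
    qed
    finally show ?thesis by (simp add: cdf A_def)
  qed
qed

section \<open>Calculus of the two weights and of \<open>u * (1 - ln u)\<close>\<close>

lemma nn_integral_one_over_id_one_minus_ln:
  fixes a :: real
  assumes "0 < a" "a \<le> 1"
  shows "(\<integral>\<^sup>+u. ennreal (1 / (u * (1 - ln u))) * indicator {a..1} u \<partial>lborel) = ennreal (ln (1 - ln a))"
proof -
  have pos: "0 < 1 - ln u" if "a \<le> u" "u \<le> 1" for u
    using that assms ln_le_zero_iff[of u] by linarith
  have "(\<integral>\<^sup>+u. ennreal (1 / (u * (1 - ln u))) * indicator {a..1} u \<partial>lborel) =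
      ennreal (- ln (1 - ln 1) - - ln (1 - ln a))"
  proof (rule nn_integral_FTC_Icc)
    fix u assume "u \<in> {a..1}"
    then have u: "a \<le> u" "u \<le> 1" by auto
    have "((\<lambda>u. - ln (1 - ln u)) has_real_derivative - (1 / (1 - ln u) * (0 - 1 / u))) (at u)"
      using u assms pos[OF u]
      by (intro DERIV_minus DERIV_chain2[OF DERIV_ln_divide] DERIV_diff DERIV_const DERIV_ln_divide) auto
    then show "((\<lambda>u. - ln (1 - ln u)) has_real_derivative 1 / (u * (1 - ln u))) (at u)"
      by (simp add: mult.commute)
    show "0 \<le> 1 / (u * (1 - ln u))" using u assms pos[OF u] by simp
  qed (use assms in auto)
  then show ?thesis by simp
qed

text \<open>With \<open>c = 1 - ln u\<close> one has
  \<open>(ln u)^2 / c^2 = 1 - 2 / c + 1 / c^2\<close>. After division by \<open>u\<close> the three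
  terms have antiderivatives \<open>ln u\<close>, \<open>2 * ln c\<close> and
  \<open>1 / c\<close>.\<close>

lemma DERIV_entropy_weight:
  fixes u :: real
  assumes "0 < u" "u \<le> 1"
  shows "((\<lambda>u. ln u + 2 * ln (1 - ln u) + 1 / (1 - ln u)) has_real_derivative
    (ln u)\<^sup>2 / (u * (1 - ln u)\<^sup>2)) (at u)"
proof -
  have *: "0 < 1 - ln u"
    using assms ln_le_zero_iff[of u] by linarith
  then have "1 / u + 2 * ((- (1 / u)) / (1 - ln u)) + (1 / u) / (1 - ln u)\<^sup>2 =
      (ln u)\<^sup>2 / (u * (1 - ln u)\<^sup>2)"
    using assms by (simp add: divide_simps power2_eq_square) (simp add: algebra_simps)
  moreover have "((\<lambda>u. ln u + 2 * ln (1 - ln u) + 1 / (1 - ln u)) has_real_derivative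
      1 / u + 2 * ((- (1 / u)) / (1 - ln u)) + (1 / u) / (1 - ln u)\<^sup>2) (at u)"
    using * assms by (auto intro!: derivative_eq_intros simp: power2_eq_square)
  ultimately show ?thesis by simp
qed

lemma nn_integral_ln_sq_over:
  fixes a :: real
  assumes "0 < a" "a \<le> 1"
  shows "(\<integral>\<^sup>+u. ennreal ((ln u)\<^sup>2 / (u * (1 - ln u)\<^sup>2)) * indicator {a..1} u \<partial>lborel) =
    ennreal (- ln a - 2 * ln (1 - ln a) + 1 - 1 / (1 - ln a))"
proof -
  have "(\<integral>\<^sup>+u. ennreal ((ln u)\<^sup>2 / (u * (1 - ln u)\<^sup>2)) * indicator {a..1} u \<partial>lborel) =
      ennreal ((ln 1 + 2 * ln (1 - ln 1) + 1 / (1 - ln 1)) - (ln a + 2 * ln (1 - ln a) + 1 / (1 - ln a)))"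
    using assms by (intro nn_integral_FTC_Icc DERIV_entropy_weight) auto
  then show ?thesis by (simp add: algebra_simps)
qed

text \<open>The expression is the increase over \<open>{a..1}\<close> of an antiderivative of a
  nonnegative weight. The integral formula does not yield this by itself, since
  \<open>ennreal\<close> sends negative reals to 0.\<close>

lemma entropy_weight_nonneg:
  fixes a :: real
  assumes "0 < a" "a \<le> 1"
  shows "0 \<le> - ln a - 2 * ln (1 - ln a) + 1 - 1 / (1 - ln a)"
proof -
  have "ln a + 2 * ln (1 - ln a) + 1 / (1 - ln a) \<le> ln 1 + 2 * ln (1 - ln 1) + 1 / (1 - ln (1::real))"
  proof (rule DERIV_nonneg_imp_nondecreasing[OF assms(2)])
    fix u :: real assume "a \<le> u" "u \<le> 1"
    then show "\<exists>y. ((\<lambda>u. ln u + 2 * ln (1 - ln u) + 1 / (1 - ln u)) has_real_derivative y) (at u) \<and> 0 \<le> y"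
      using assms
      by (intro exI[of _ "(ln u)\<^sup>2 / (u * (1 - ln u)\<^sup>2)"] conjI DERIV_entropy_weight) auto
  qed
  then show ?thesis by simp
qed

text \<open>This is the map taking \<open>F\<close> to \<open>G\<close>. The delicate point is 0,
  where the limit from the right agrees with the value 0 of the product.\<close>

lemma continuous_on_id_one_minus_ln: "continuous_on {0..} (\<lambda>u::real. u * (1 - ln u))"
proof -
  have "((\<lambda>u::real. u * (1 - ln u)) \<longlongrightarrow> 0) (at_right 0)" by real_asymp
  then have 0: "((\<lambda>u::real. u * (1 - ln u)) \<longlongrightarrow> 0) (at 0 within {0..})"
    by (simp add: at_within_Ici_at_right)
  show ?thesis
    unfolding continuous_on_def
  proof
    fix u :: real assume "u \<in> {0..}"
    show "((\<lambda>u. u * (1 - ln u)) \<longlongrightarrow> u * (1 - ln u)) (at u within {0..})"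
    proof (cases "u = 0")
      case True then show ?thesis using 0 by simp
    next
      case False then show ?thesis by (auto intro!: tendsto_eq_intros)
    qed
  qed
qed

text \<open>This identity makes \<open>G\<close> the CDF of the law with density
  \<open>- ln F\<close> relative to the law of \<open>F\<close>. The antiderivative is only
  continuous at 0, hence the interior form of the fundamental theorem.\<close>

lemma nn_integral_minus_ln:
  fixes b :: real
  assumes "0 \<le> b" "b \<le> 1"
  shows "(\<integral>\<^sup>+u. ennreal (- ln u) * indicator {0..b} u \<partial>lborel) = ennreal (b * (1 - ln b))"
proof -
  have "((\<lambda>u. - ln u) has_integral (b * (1 - ln b) - 0 * (1 - ln 0))) {0..b}"
  proof (rule fundamental_theorem_of_calculus_interior)
    show "continuous_on {0..b} (\<lambda>u. u * (1 - ln u))"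
      by (rule continuous_on_subset[OF continuous_on_id_one_minus_ln]) auto
    show "((\<lambda>u. u * (1 - ln u)) has_vector_derivative - ln u) (at u)" if "u \<in> {0<..<b}" for u
      unfolding has_real_derivative_iff_has_vector_derivative[symmetric]
      using that by (auto intro!: derivative_eq_intros)
  qed fact
  moreover have "0 \<le> - ln u" if "u \<in> {0..b}" for u
    using that assms(2) by (cases "u = 0") auto
  ultimately have "(\<integral>\<^sup>+u. ennreal (- ln u) * indicator {0..b} u \<partial>lborel) =
      ennreal (b * (1 - ln b) - 0 * (1 - ln 0))"
    by (rule nn_integral_has_integral_lebesgue'[rotated])
  then show ?thesis by (simp only: mult_zero_left diff_0_right)
qed

text \<open>Write \<open>a = exp (- T)\<close> and multiply
  \<open>1 + T + T^2 / 2 \<le> exp T\<close> by \<open>a\<close>. The bounds let the tail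
  \<open>1 - F\<close> dominate \<open>F T\<close> and \<open>F T^2\<close>.\<close>

lemma entropy_bounds:
  fixes a :: real
  assumes "0 < a" "a \<le> 1"
  shows "a * (- ln a) \<le> 1 - a" "a * (ln a)\<^sup>2 \<le> 2 * (1 - a)"
proof -
  define T where "T = - ln a"
  have T: "0 \<le> T" "a = exp (- T)" using assms by (auto simp: T_def)
  have "1 + T + T\<^sup>2 / 2 \<le> exp T" using exp_lower_Taylor_quadratic[OF T(1)] .
  then have "a * (1 + T + T\<^sup>2 / 2) \<le> a * exp T" using assms by (intro mult_left_mono) auto
  also have "a * exp T = 1" using T(2) by (simp add: exp_minus)
  finally have "a + a * T + a * T\<^sup>2 / 2 \<le> 1" by (simp add: algebra_simps)
  moreover have "0 \<le> a * T" "0 \<le> a * T\<^sup>2" using assms T(1) by auto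
  ultimately show "a * (- ln a) \<le> 1 - a" "a * (ln a)\<^sup>2 \<le> 2 * (1 - a)" by (auto simp: T_def)
qed

section \<open>Layer-cake formulas for a law with continuous CDF vanishing at 0\<close>

context real_distribution
begin

context
  assumes cont: "continuous_on UNIV (cdf M)" and zero: "cdf M 0 = 0"
begin

lemma AE_pos_of_cdf_zero: "AE t in M. 0 < t"
  using AE_cdf_neq[OF cont, of 0]
proof eventually_elim
  case (elim t)
  then show ?case using zero cdf_nondecreasing[of t 0] cdf_nonneg[of t] by (cases "0 < t") auto
qed

text \<open>The Tonelli identity with \<open>W = 1\<close> and \<open>g = 1\<close>, where the inner
  integrals are \<open>t\<close> and \<open>1 - cdf M x\<close>.\<close>

lemma nn_integral_eq_tail:
  "(\<integral>\<^sup>+t. ennreal t \<partial>M) = (\<integral>\<^sup>+x. ennreal (1 - cdf M x) * indicator {0<..} x \<partial>lborel)"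
proof -
  have 1: "(\<integral>\<^sup>+x. 1 * indicator {0<..<t} x \<partial>lborel) = ennreal t" for t :: real
    by (cases "0 \<le> t") (auto simp: ennreal_neg)
  have 2: "(\<integral>\<^sup>+u. 1 * indicator {cdf M x..1} u \<partial>lborel) = ennreal (1 - cdf M x)" for x
    using cdf_bounded_prob[of x] by simp
  show ?thesis
    using nn_integral_cdf_Tonelli[OF cont, of "\<lambda>_. 1" "\<lambda>_. 1"] unfolding 1 2 by simp
qed

lemma expectation_eq_tail:
  "integrable M (\<lambda>x. x) \<longleftrightarrow> set_integrable lborel {0<..} (\<lambda>x. 1 - cdf M x)" (is ?int)
  "(\<integral>x. x \<partial>M) = (LBINT x:{0<..}. 1 - cdf M x)" (is ?eq)
proof -
  have [measurable]: "cdf M \<in> borel_measurable borel"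
    by (intro borel_measurable_mono) (simp add: mono_def cdf_nondecreasing)
  have nn: "(\<integral>\<^sup>+x. ennreal (indicator {0<..} x *\<^sub>R (1 - cdf M x)) \<partial>lborel) = (\<integral>\<^sup>+t. ennreal t \<partial>M)"
    unfolding nn_integral_eq_tail by (intro nn_integral_cong) (auto split: split_indicator)
  have nonneg: "0 \<le> indicator {0<..} x *\<^sub>R (1 - cdf M x)" for x using cdf_bounded_prob[of x] by simp
  have nonneg': "AE x in M. 0 \<le> x" using AE_pos_of_cdf_zero by eventually_elim simp
  have "(\<integral>\<^sup>+t. ennreal \<bar>t\<bar> \<partial>M) = (\<integral>\<^sup>+t. ennreal t \<partial>M)"
    using nonneg' by (intro nn_integral_cong_AE, eventually_elim) simp
  then show ?int
    unfolding set_integrable_def integrable_iff_bounded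
    using nn nonneg by (simp del: real_scaleR_def)
  show ?eq
    unfolding set_lebesgue_integral_def
    using nn nonneg nonneg' by (simp add: integral_eq_nn_integral del: real_scaleR_def)
qed

text \<open>Real-valued form of the exchange: nonnegativity of \<open>W\<close>, \<open>g\<close>
  and \<open>V\<close> permits the passage through \<open>ennreal\<close>, and integrability of the
  Lebesgue side yields that of the expectation.\<close>

lemma has_bochner_integral_cdf_Tonelli:
  assumes pos: "\<And>x. 0 < x \<Longrightarrow> 0 < cdf M x"
    and W[measurable]: "W \<in> borel_measurable borel" "\<And>u. 0 \<le> W u"
    and g[measurable]: "g \<in> borel_measurable borel" "\<And>x. 0 \<le> g x" "\<And>t. set_integrable lborel {0..t} g"
    and V: "\<And>a. 0 < a \<Longrightarrow> a \<le> 1 \<Longrightarrow> (\<integral>\<^sup>+u. ennreal (W u) * indicator {a..1} u \<partial>lborel) = ennreal (V a)"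
      "\<And>a. 0 < a \<Longrightarrow> a \<le> 1 \<Longrightarrow> 0 \<le> V a"
    and int: "set_integrable lborel {0<..} (\<lambda>x. g x * V (cdf M x))"
  shows "has_bochner_integral M (\<lambda>t. W (cdf M t) * (LBINT x:{0..t}. g x)) (LBINT x:{0<..}. g x * V (cdf M x))"
proof (rule has_bochner_integral_nn_integral)
  have [measurable]: "cdf M \<in> borel_measurable borel"
    by (intro borel_measurable_mono) (simp add: mono_def cdf_nondecreasing)
  have "(\<lambda>t. LBINT x:{0..t}. g x) = (\<lambda>t. LBINT x. of_bool (0 \<le> x \<and> x \<le> t) * g x)"
    by (auto simp: set_lebesgue_integral_def indicator_def)
  then have [measurable]: "(\<lambda>t. LBINT x:{0..t}. g x) \<in> borel_measurable borel" by simp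
  show "(\<lambda>t. W (cdf M t) * (LBINT x:{0..t}. g x)) \<in> borel_measurable M" by simp
  have H: "ennreal (LBINT x:{0..t}. g x) = (\<integral>\<^sup>+x. ennreal (g x) * indicator {0<..<t} x \<partial>lborel)" for t
  proof -
    have "ennreal (LBINT x:{0..t}. g x) = (\<integral>\<^sup>+x. ennreal (indicator {0..t} x *\<^sub>R g x) \<partial>lborel)"
      unfolding set_lebesgue_integral_def using g(2,3)
      by (intro nn_integral_eq_integral[symmetric]) (auto simp: set_integrable_def)
    also have "\<dots> = (\<integral>\<^sup>+x. ennreal (g x) * indicator {0<..<t} x \<partial>lborel)"
      using AE_lborel_singleton[of 0] AE_lborel_singleton[of t]
      by (intro nn_integral_cong_AE, eventually_elim) (auto split: split_indicator)
    finally show ?thesis .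
  qed
  have H_nonneg: "0 \<le> (LBINT x:{0..t}. g x)" for t
    unfolding set_lebesgue_integral_def using g(2) by (intro Bochner_Integration.integral_nonneg) auto
  then show "AE t in M. 0 \<le> W (cdf M t) * (LBINT x:{0..t}. g x)" using W(2) by simp
  have V_nonneg: "0 \<le> indicator {0<..} x *\<^sub>R (g x * V (cdf M x))" for x :: real
    using g(2) V(2) pos cdf_bounded_prob[of x] by (auto split: split_indicator)
  then show "0 \<le> (LBINT x:{0<..}. g x * V (cdf M x))"
    unfolding set_lebesgue_integral_def by (intro Bochner_Integration.integral_nonneg)
  have "(\<integral>\<^sup>+t. ennreal (W (cdf M t) * (LBINT x:{0..t}. g x)) \<partial>M) =
      (\<integral>\<^sup>+t. ennreal (W (cdf M t)) * (\<integral>\<^sup>+x. ennreal (g x) * indicator {0<..<t} x \<partial>lborel) \<partial>M)"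
    by (simp add: ennreal_mult W(2) H_nonneg H)
  also have "\<dots> = (\<integral>\<^sup>+x. ennreal (g x) * (\<integral>\<^sup>+u. ennreal (W u) * indicator {cdf M x..1} u \<partial>lborel) * indicator {0<..} x \<partial>lborel)"
    by (intro nn_integral_cdf_Tonelli[OF cont]) auto
  also have "\<dots> = (\<integral>\<^sup>+x. ennreal (indicator {0<..} x *\<^sub>R (g x * V (cdf M x))) \<partial>lborel)"
    using g(2) V pos cdf_bounded_prob
    by (intro nn_integral_cong) (auto simp: ennreal_mult split: split_indicator)
  also have "\<dots> = ennreal (LBINT x:{0<..}. g x * V (cdf M x))"
    unfolding set_lebesgue_integral_def using int V_nonneg
    by (intro nn_integral_eq_integral) (auto simp: set_integrable_def)
  finally show "(\<integral>\<^sup>+t. ennreal (W (cdf M t) * (LBINT x:{0..t}. g x)) \<partial>M) =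
    ennreal (LBINT x:{0<..}. g x * V (cdf M x))" .
qed

end

end

subsection \<open>One step of the recursion\<close>

text \<open>\<open>D\<close> and \<open>D'\<close> stand for the laws of two consecutive variables.
  The recursion is required on the positive half-line only, as in the theorem;
  \<open>cdf_step\<close> recovers the rest.\<close>

locale cdf_log_step = D: real_distribution D + D': real_distribution D'
  for D D' :: "real measure" +
  assumes cont: "continuous_on UNIV (cdf D)"
    and zero: "x \<le> 0 \<Longrightarrow> cdf D x = 0"
    and pos: "0 < x \<Longrightarrow> 0 < cdf D x"
    and step: "0 < x \<Longrightarrow> cdf D' x = cdf D x * (1 - ln (cdf D x))"
begin

lemma cdf_borel[measurable]: "cdf D \<in> borel_measurable borel" "cdf D' \<in> borel_measurable borel"
  by (intro borel_measurable_mono; simp add: mono_def D.cdf_nondecreasing D'.cdf_nondecreasing)+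

text \<open>The right-hand side tends to 0 at 0 from the right, so right continuity forces
  \<open>cdf D' 0 = 0\<close>, and monotonicity settles negative \<open>x\<close>.\<close>

lemma cdf_step: "cdf D' x = cdf D x * (1 - ln (cdf D x))"
proof (cases "0 < x")
  case False
  have "continuous_on UNIV (\<lambda>x. cdf D x * (1 - ln (cdf D x)))"
    by (rule continuous_on_compose2[OF continuous_on_id_one_minus_ln cont]) (auto simp: D.cdf_nonneg)
  then have "isCont (\<lambda>x. cdf D x * (1 - ln (cdf D x))) 0"
    by (simp add: continuous_on_eq_continuous_at)
  then have "((\<lambda>x. cdf D x * (1 - ln (cdf D x))) \<longlongrightarrow> 0) (at_right 0)"
    using zero[of 0] by (simp add: isCont_def filterlim_at_split)
  moreover have "\<forall>\<^sub>F x in at_right 0. cdf D x * (1 - ln (cdf D x)) = cdf D' x"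
    using eventually_at_right_less[of "0::real"] by eventually_elim (simp add: step)
  ultimately have "(cdf D' \<longlongrightarrow> 0) (at_right 0)"
    by (rule Lim_transform_eventually)
  moreover have "(cdf D' \<longlongrightarrow> cdf D' 0) (at_right 0)"
    using D'.cdf_is_right_cont[of 0] by (simp add: continuous_within)
  ultimately have "cdf D' 0 = 0"
    using tendsto_unique[of "at_right (0::real)" "cdf D'"] by auto
  then show ?thesis
    using False zero[of x] D'.cdf_nondecreasing[of x 0] D'.cdf_nonneg[of x] by simp
qed (rule step)

lemma cont': "continuous_on UNIV (cdf D')"
  unfolding cdf_step[abs_def]
  by (rule continuous_on_compose2[OF continuous_on_id_one_minus_ln cont]) (auto simp: D.cdf_nonneg)

lemma zero': "x \<le> 0 \<Longrightarrow> cdf D' x = 0"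
  by (simp add: cdf_step zero)

lemma ln_cdf_nonpos: "ln (cdf D x) \<le> 0"
  using pos[of x] zero[of x] D.cdf_bounded_prob[of x] by (cases "0 < x") auto

lemma cdf_le: "cdf D x \<le> cdf D' x"
proof -
  have "0 \<le> cdf D x * - ln (cdf D x)"
    using ln_cdf_nonpos[of x] D.cdf_nonneg[of x] by (intro mult_nonneg_nonneg) auto
  then show ?thesis unfolding cdf_step by (simp add: algebra_simps)
qed

lemma pos': "0 < x \<Longrightarrow> 0 < cdf D' x"
  using pos cdf_le by (metis less_le_trans)

text \<open>The integral transform turns the mass of \<open>{..t}\<close> under the candidate into
  the integral of \<open>- ln u\<close> over \<open>{0..cdf D t}\<close>, which is
  \<open>cdf D' t\<close>. This is the density recursion at the level of measures.\<close>

lemma step_density: "D' = density D (\<lambda>x. ennreal (- ln (cdf D x)))" (is "_ = ?E")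
proof (rule cdf_unique)
  have "emeasure ?E (space ?E) = (\<integral>\<^sup>+x. ennreal (- ln (cdf D x)) \<partial>D)"
    by (subst emeasure_density) auto
  also have "\<dots> = 1"
    by (subst D.nn_integral_cdf[OF cont]) (simp_all add: nn_integral_minus_ln)
  finally have "prob_space ?E" by (rule prob_spaceI)
  then show E: "real_distribution ?E"
    by (intro real_distribution.intro real_distribution_axioms.intro) auto
  then interpret E: real_distribution ?E .
  show "cdf D' = cdf ?E"
  proof
    fix t
    have "emeasure ?E {..t} = (\<integral>\<^sup>+x. ennreal (- ln (cdf D x)) * indicator {..t} x \<partial>D)"
      by (subst emeasure_density) auto
    also have "\<dots> = ennreal (cdf D' t)"
      using D.cdf_nonneg D.cdf_bounded_prob
      by (subst D.nn_integral_cdf_atMost[OF cont]) (simp_all add: nn_integral_minus_ln cdf_step)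
    finally show "cdf D' t = cdf ?E t"
      using D'.cdf_nonneg[of t] by (simp add: cdf_def[of ?E] measure_def)
  qed
qed (rule D'.real_distribution_axioms)

lemma cdf_step_has_derivative:
  assumes "0 < t" "(cdf D has_real_derivative d) (at t)"
  shows "(cdf D' has_real_derivative - ln (cdf D t) * d) (at t)"
  unfolding cdf_step[abs_def] using pos[OF assms(1)]
  by (auto intro!: derivative_eq_intros assms(2) simp: field_simps)

section \<open>Mean inactivity time of the successor law\<close>

definition mit :: "real \<Rightarrow> real" where
  "mit t = (LBINT x:{0..t}. cdf D' x) / cdf D' t"

lemma cdf_integrable_Icc: "set_integrable lborel {a..b} (cdf D')"
  using borel_integrable_atLeastAtMost'[OF continuous_on_subset[OF cont']] by simp

lemma cumulative_has_derivative:
  assumes "0 < t"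
  shows "((\<lambda>t. LBINT x:{0..t}. cdf D' x) has_real_derivative cdf D' t) (at t)"
proof -
  \<comment> \<open>The right end \<open>t + 1\<close> only makes \<open>t\<close> interior, so that
    the derivative within the interval is two-sided.\<close>
  have "((\<lambda>u. integral {0..u} (cdf D')) has_real_derivative cdf D' t) (at t within {0..t + 1})"
    using assms by (intro integral_has_real_derivative continuous_on_subset[OF cont']) auto
  then have "((\<lambda>u. integral {0..u} (cdf D')) has_real_derivative cdf D' t) (at t)"
    using assms by (subst (asm) at_within_interior) auto
  then show ?thesis
    using cdf_integrable_Icc by (simp add: set_borel_integral_eq_integral)
qed

text \<open>Quotient rule for \<open>H / G\<close> with \<open>H' = G\<close> and
  \<open>G' = - ln F * d\<close>.\<close>

lemma mit_has_derivative:
  assumes t: "0 < t" and d: "(cdf D has_real_derivative d) (at t)"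
  shows "(mit has_real_derivative 1 - (- ln (cdf D t) * d) / cdf D' t * mit t) (at t)"
  unfolding mit_def[abs_def] using pos'[OF t]
  by (auto intro!: derivative_eq_intros cumulative_has_derivative[OF t] cdf_step_has_derivative[OF t d]
      simp: field_simps power2_eq_square)

text \<open>Since \<open>G\<close> is nondecreasing, \<open>H t \<le> t * G t\<close>. The bounds
  control the quotient at 0, where \<open>H\<close> and \<open>G\<close> both vanish.\<close>

lemma mit_bounds:
  assumes "0 \<le> t" shows "0 \<le> mit t" "mit t \<le> t"
proof -
  have "0 \<le> (LBINT x:{0..t}. cdf D' x)"
    unfolding set_lebesgue_integral_def by (intro Bochner_Integration.integral_nonneg) (auto simp: D'.cdf_nonneg)
  then show "0 \<le> mit t" by (auto simp: mit_def D'.cdf_nonneg)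
  have "(LBINT x:{0..t}. cdf D' x) \<le> (LBINT x:{0..t}. cdf D' t)"
    by (intro set_integral_mono cdf_integrable_Icc borel_integrable_atLeastAtMost'[OF continuous_on_const])
      (auto simp: D'.cdf_nondecreasing)
  also have "\<dots> = t * cdf D' t" using assms by (simp add: set_lebesgue_integral_def)
  finally show "mit t \<le> t"
    using assms D'.cdf_nonneg[of t] by (cases "cdf D' t = 0") (auto simp: mit_def divide_le_eq)
qed

lemma mit_nonpos: "t \<le> 0 \<Longrightarrow> mit t = 0"
  by (simp add: mit_def zero')

text \<open>Continuity on the whole line is what \<open>borel_measurable_deriv\<close> asks for to
  make \<open>deriv mit\<close> measurable.\<close>

lemma mit_continuous: "continuous_on UNIV mit"
proof -
  have "isCont mit t" for t
  proof -
    consider "0 < t" | "t = 0" | "t < 0" by linarith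
    then show ?thesis
    proof cases
      case 1
      have "isCont (cdf D') t" using cont' by (simp add: continuous_on_eq_continuous_at)
      then show ?thesis
        unfolding mit_def[abs_def] using pos'[OF 1] DERIV_isCont[OF cumulative_has_derivative[OF 1]]
        by (intro continuous_intros) auto
    next
      case 2
      have "\<bar>mit x\<bar> \<le> \<bar>x\<bar>" for x using mit_bounds[of x] mit_nonpos[of x] by (cases "0 \<le> x") auto
      then have "(mit \<longlongrightarrow> 0) (at 0)"
        by (intro Lim_null_comparison[of mit "\<lambda>x. \<bar>x\<bar>"]) (auto intro!: tendsto_eq_intros)
      then show ?thesis using 2 by (simp add: isCont_def mit_nonpos)
    next
      case 3
      have "\<forall>\<^sub>F x in nhds t. mit x = 0"
        using eventually_nhds_in_open[of "{..<0}" t] 3 by (auto elim!: eventually_mono simp: mit_nonpos)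
      then show ?thesis using isCont_cong[of mit "\<lambda>_. 0" t] by simp
    qed
  qed
  then show ?thesis by (simp add: continuous_at_imp_continuous_on)
qed

section \<open>Integral identities under a finite mean\<close>

context
  assumes mean: "integrable D (\<lambda>x. x)"
begin

lemma tail_integrable: "set_integrable lborel {0<..} (\<lambda>x. 1 - cdf D x)"
  using mean D.expectation_eq_tail(1)[OF cont zero] by simp

text \<open>A finite mean amounts to an integrable tail \<open>1 - F\<close>, which thus serves as
  the common dominating function.\<close>

lemma integrable_of_tail_bound:
  assumes [measurable]: "\<phi> \<in> borel_measurable borel"
    and "\<And>x. 0 < x \<Longrightarrow> \<bar>\<phi> x\<bar> \<le> C * (1 - cdf D x)"
  shows "set_integrable lborel {0<..} \<phi>"
  by (rule set_integrable_bound[OF set_integrable_mult_right[OF tail_integrable, of C]])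
    (use assms in \<open>auto simp: set_borel_measurable_def intro: order_trans[OF _ abs_ge_self]\<close>)

lemma step_integrable: "integrable D' (\<lambda>x. x)"
proof -
  have "set_integrable lborel {0<..} (\<lambda>x. 1 - cdf D' x)"
    using cdf_le D'.cdf_bounded_prob by (intro integrable_of_tail_bound[of _ 1]) auto
  then show ?thesis using D'.expectation_eq_tail(1)[OF cont' zero'] by simp
qed

lemma FT_integrable: "set_integrable lborel {0<..} (\<lambda>x. cdf D x * - ln (cdf D x))"
proof (rule integrable_of_tail_bound[of _ 1])
  fix x :: real assume "0 < x"
  then show "\<bar>cdf D x * - ln (cdf D x)\<bar> \<le> 1 * (1 - cdf D x)"
    using entropy_bounds(1)[OF pos D.cdf_bounded_prob, of x] ln_cdf_nonpos[of x] D.cdf_nonneg[of x]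
    by (simp add: abs_mult)
qed simp

lemma FTT_integrable: "set_integrable lborel {0<..} (\<lambda>x. cdf D x * (ln (cdf D x))\<^sup>2)"
proof (rule integrable_of_tail_bound[of _ 2])
  fix x :: real assume "0 < x"
  then show "\<bar>cdf D x * (ln (cdf D x))\<^sup>2\<bar> \<le> 2 * (1 - cdf D x)"
    using entropy_bounds(2)[OF pos D.cdf_bounded_prob, of x] D.cdf_nonneg[of x]
    by (simp add: abs_mult)
qed simp

text \<open>\<open>G T = F T + F T^2\<close>.\<close>

lemma GT_integrable: "set_integrable lborel {0<..} (\<lambda>x. cdf D' x * - ln (cdf D x))"
  using set_integral_add(1)[OF FT_integrable FTT_integrable]
  by (simp add: cdf_step algebra_simps power2_eq_square)

text \<open>Dominated by \<open>G T\<close>, because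
  \<open>0 \<le> ln (1 + T) \<le> T\<close>.\<close>

lemma G_ln_integrable: "set_integrable lborel {0<..} (\<lambda>x. cdf D' x * ln (1 - ln (cdf D x)))"
proof (rule set_integrable_bound[OF GT_integrable], goal_cases)
  case 2
  have "\<bar>cdf D' x * ln (1 - ln (cdf D x))\<bar> \<le> \<bar>cdf D' x * - ln (cdf D x)\<bar>" for x
  proof -
    have "0 \<le> ln (1 - ln (cdf D x))" "ln (1 - ln (cdf D x)) \<le> - ln (cdf D x)"
      using ln_cdf_nonpos[of x] ln_add_one_self_le_self[of "- ln (cdf D x)"] by auto
    then show ?thesis
      using D'.cdf_nonneg[of x] ln_cdf_nonpos[of x]
        mult_left_mono[of "ln (1 - ln (cdf D x))" "- ln (cdf D x)" "cdf D' x"]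
      by (simp add: abs_mult)
  qed
  then show ?case by simp
qed (simp add: set_borel_measurable_def)

text \<open>Subtract the two tail formulas: \<open>(1 - F) - (1 - G) = F T\<close>.\<close>

lemma means_gap: "(\<integral>x. x \<partial>D) - (\<integral>x. x \<partial>D') = (LBINT x:{0<..}. cdf D x * - ln (cdf D x))"
proof -
  have "(\<integral>x. x \<partial>D) = (LBINT x:{0<..}. 1 - cdf D x)" "(\<integral>x. x \<partial>D') = (LBINT x:{0<..}. 1 - cdf D' x)"
    using D.expectation_eq_tail(2)[OF cont zero] D'.expectation_eq_tail(2)[OF cont' zero'] by simp_all
  moreover have "set_integrable lborel {0<..} (\<lambda>x. 1 - cdf D' x)"
    using step_integrable D'.expectation_eq_tail(1)[OF cont' zero'] by simp
  ultimately show ?thesis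
    using tail_integrable
    by (simp add: set_integral_diff(2)[symmetric] cdf_step algebra_simps)
qed

text \<open>The integrand is positive wherever \<open>F\<close> lies strictly between 0 and 1. By
  continuity that set is open, it contains a point of level 1/2, and a nonempty open set is not
  negligible.\<close>

lemma entropy_pos: "0 < (LBINT x:{0<..}. cdf D x * - ln (cdf D x))"
proof -
  let ?f = "\<lambda>x. indicator {0<..} x *\<^sub>R (cdf D x * - ln (cdf D x))"
  have nonneg: "0 \<le> ?f x" for x
    using D.cdf_nonneg[of x] ln_cdf_nonpos[of x] by (auto simp: mult_le_0_iff split: split_indicator)
  have int: "integrable lborel ?f" using FT_integrable by (simp add: set_integrable_def)
  define U where "U = cdf D -` {0<..<1}"
  have "open U" unfolding U_def using cont by (intro open_vimage) (auto simp: continuous_on_eq_continuous_at)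
  obtain b where b: "1 / 2 < cdf D b"
    using order_tendstoD(1)[OF D.cdf_lim_at_top_prob, of "1/2"]
      eventually_happens'[OF trivial_limit_at_top_linorder] by auto
  have "0 \<le> b" using b zero[of b] by (cases "0 \<le> b") auto
  then obtain s where "cdf D s = 1 / 2"
    using IVT'[of "cdf D" 0 "1/2" b] b zero[of 0] continuous_on_subset[OF cont] by auto
  then have "s \<in> U" by (simp add: U_def)
  have "\<not> (AE x in lborel. ?f x = 0)"
  proof
    assume "AE x in lborel. ?f x = 0"
    then have "AE x in lborel. x \<notin> U"
    proof eventually_elim
      case (elim x)
      then show ?case using zero[of x] by (cases "0 < x") (auto simp: U_def)
    qed
    then have "U \<in> null_sets lborel"
      using \<open>open U\<close> by (subst (asm) AE_iff_null_sets[symmetric]) auto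
    then have "negligible U" by (simp add: negligible_iff_null_sets null_sets_completionI)
    then show False using open_not_negligible[OF \<open>open U\<close>] \<open>s \<in> U\<close> by auto
  qed
  then have "integral\<^sup>L lborel ?f \<noteq> 0"
    using integral_nonneg_eq_0_iff_AE[OF int] nonneg by auto
  moreover have "0 \<le> integral\<^sup>L lborel ?f" using nonneg by (intro Bochner_Integration.integral_nonneg) auto
  ultimately show ?thesis by (simp add: set_lebesgue_integral_def)
qed

text \<open>The weight \<open>1 / (u * (1 - ln u))\<close> at \<open>u = F\<close> is
  \<open>1 / G\<close>, so the Tonelli lemma applied to \<open>g = G\<close> computes the
  expectation of \<open>H / G\<close>.\<close>

lemma mit_expectation:
  "has_bochner_integral D mit (LBINT x:{0<..}. cdf D' x * ln (1 - ln (cdf D x)))"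
proof -
  \<comment> \<open>The Tonelli lemma wants a weight that is nonnegative everywhere, and this one is
    negative for \<open>u > exp 1\<close>; the absolute value changes nothing on
    \<open>{a..1}\<close>.\<close>
  have "has_bochner_integral D (\<lambda>t. \<bar>1 / (cdf D t * (1 - ln (cdf D t)))\<bar> * (LBINT x:{0..t}. cdf D' x))
      (LBINT x:{0<..}. cdf D' x * ln (1 - ln (cdf D x)))"
  proof (rule D.has_bochner_integral_cdf_Tonelli[OF cont zero pos, where W = "\<lambda>u. \<bar>1 / (u * (1 - ln u))\<bar>"])
    fix a :: real assume a: "0 < a" "a \<le> 1"
    have "(\<integral>\<^sup>+u. ennreal \<bar>1 / (u * (1 - ln u))\<bar> * indicator {a..1} u \<partial>lborel) =
        (\<integral>\<^sup>+u. ennreal (1 / (u * (1 - ln u))) * indicator {a..1} u \<partial>lborel)"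
    proof (intro nn_integral_cong)
      fix u
      have "0 \<le> 1 / (u * (1 - ln u))" if "u \<in> {a..1}"
      proof -
        have "ln u \<le> 0" using that a by simp
        then have "0 < 1 - ln u" by linarith
        moreover have "0 < u" using that a by simp
        ultimately show ?thesis by simp
      qed
      then show "ennreal \<bar>1 / (u * (1 - ln u))\<bar> * indicator {a..1} u =
          ennreal (1 / (u * (1 - ln u))) * indicator {a..1} u"
        by (cases "u \<in> {a..1}") auto
    qed
    then show "(\<integral>\<^sup>+u. ennreal \<bar>1 / (u * (1 - ln u))\<bar> * indicator {a..1} u \<partial>lborel) = ennreal (ln (1 - ln a))"
      using nn_integral_one_over_id_one_minus_ln[OF a] by simp
    show "0 \<le> ln (1 - ln a)" using a by simp
  qed (auto simp: D'.cdf_nonneg cdf_integrable_Icc G_ln_integrable)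
  moreover have "\<bar>1 / (cdf D t * (1 - ln (cdf D t)))\<bar> * (LBINT x:{0..t}. cdf D' x) = mit t" for t
    using D'.cdf_nonneg[of t] by (simp add: cdf_step[symmetric] mit_def)
  ultimately show ?thesis by simp
qed

text \<open>Inserting \<open>mit' = 1 - \<tau> * mit\<close> splits the integrand into
  \<open>F T\<close> and \<open>h * w F * H\<close>. As \<open>h\<close> is a density of
  \<open>D\<close>, the second part is an expectation under \<open>D\<close>, which the Tonelli
  lemma evaluates with weight \<open>w\<close> and primitive \<open>v\<close>.\<close>

lemma deriv_mit_gap:
  assumes [measurable]: "h \<in> borel_measurable borel" and h: "\<And>t. 0 \<le> h t"
    and D: "D = density lborel (\<lambda>t. ennreal (h t))"
    and deriv: "AE t in lborel. 0 < t \<longrightarrow>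
      (mit has_real_derivative 1 - (- ln (cdf D t) * h t) / cdf D' t * mit t) (at t)"
  shows "has_bochner_integral lborel
    (\<lambda>z. indicator {0<..} z * (cdf D z * - ln (cdf D z)) * deriv mit z)
    (2 * (LBINT x:{0<..}. cdf D' x * ln (1 - ln (cdf D x))) - (LBINT x:{0<..}. cdf D' x * - ln (cdf D x)))"
proof -
  define L where "L x = ln (cdf D x)" for x
  define w where "w u = \<bar>(ln u)\<^sup>2 / (u * (1 - ln u)\<^sup>2)\<bar>" for u :: real
  define v where "v a = - ln a - 2 * ln (1 - ln a) + 1 - 1 / (1 - ln a)" for a :: real
  have [measurable]: "w \<in> borel_measurable borel" unfolding w_def by measurable
  have [measurable]: "deriv mit \<in> borel_measurable borel"
    using borel_measurable_deriv[OF mit_continuous] .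
  define H where "H t = (LBINT x:{0..t}. cdf D' x)" for t
  \<comment> \<open>The last summand comes from
    \<open>G * (1 - 1 / (1 + T)) = G - F = F T\<close>.\<close>
  have v_eq: "cdf D' x * v (cdf D x) =
      cdf D' x * - ln (cdf D x) - 2 * (cdf D' x * ln (1 - ln (cdf D x))) + cdf D x * - ln (cdf D x)" for x
    using ln_cdf_nonpos[of x] by (simp add: v_def cdf_step field_simps)
  have v_int: "set_integrable lborel {0<..} (\<lambda>x. cdf D' x * v (cdf D x))"
    unfolding v_eq
    by (intro set_integral_add(1) set_integral_diff(1) set_integrable_mult_right FT_integrable GT_integrable G_ln_integrable)
  have v_val: "(LBINT x:{0<..}. cdf D' x * v (cdf D x)) =
      (LBINT x:{0<..}. cdf D' x * - ln (cdf D x)) - 2 * (LBINT x:{0<..}. cdf D' x * ln (1 - ln (cdf D x)))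
      + (LBINT x:{0<..}. cdf D x * - ln (cdf D x))"
    unfolding v_eq
    by (subst set_integral_add(2) set_integral_diff(2) set_integral_mult_right;
        (intro set_integral_add(1) set_integral_diff(1) set_integrable_mult_right FT_integrable GT_integrable G_ln_integrable)?)+
      (rule refl)
  have "has_bochner_integral D (\<lambda>t. w (cdf D t) * H t) (LBINT x:{0<..}. cdf D' x * v (cdf D x))"
    unfolding H_def
  proof (rule D.has_bochner_integral_cdf_Tonelli[OF cont zero pos])
    fix a :: real assume a: "0 < a" "a \<le> 1"
    have "(\<integral>\<^sup>+u. ennreal (w u) * indicator {a..1} u \<partial>lborel) =
        (\<integral>\<^sup>+u. ennreal ((ln u)\<^sup>2 / (u * (1 - ln u)\<^sup>2)) * indicator {a..1} u \<partial>lborel)"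
      using a by (intro nn_integral_cong) (auto simp: w_def abs_mult split: split_indicator)
    then show "(\<integral>\<^sup>+u. ennreal (w u) * indicator {a..1} u \<partial>lborel) = ennreal (v a)"
      using nn_integral_ln_sq_over[OF a] by (simp add: v_def)
    show "0 \<le> v a" unfolding v_def using entropy_weight_nonneg[OF a] .
  qed (auto simp: D'.cdf_nonneg cdf_integrable_Icc v_int w_def)
  moreover from this have "(\<lambda>t. w (cdf D t) * H t) \<in> borel_measurable lborel"
    using borel_measurable_has_bochner_integral by fastforce
  ultimately have "has_bochner_integral lborel (\<lambda>t. h t *\<^sub>R (w (cdf D t) * H t))
      (LBINT x:{0<..}. cdf D' x * v (cdf D x))"
    using h by (subst (asm) D) (simp add: has_bochner_integral_iff integrable_density integral_density)
  moreover have "has_bochner_integral lborel (\<lambda>z. indicator {0<..} z * (cdf D z * - ln (cdf D z)))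
      (LBINT x:{0<..}. cdf D x * - ln (cdf D x))"
    using FT_integrable by (simp add: has_bochner_integral_iff set_integrable_def set_lebesgue_integral_def)
  ultimately have diff: "has_bochner_integral lborel
      (\<lambda>z. indicator {0<..} z * (cdf D z * - ln (cdf D z)) - h z *\<^sub>R (w (cdf D z) * H z))
      ((LBINT x:{0<..}. cdf D x * - ln (cdf D x)) - (LBINT x:{0<..}. cdf D' x * v (cdf D x)))"
    by (rule has_bochner_integral_diff[rotated])
  \<comment> \<open>Read with \<open>p = F\<close>, \<open>l = ln F\<close>,
    \<open>c = 1 - l\<close>, \<open>k = h\<close> and \<open>I = H\<close>, so that
    \<open>p * c = G\<close>.\<close>
  have alg: "p * - l - k * (l\<^sup>2 / (p * c\<^sup>2) * I) = p * - l * (1 - (- l * k) / (p * c) * (I / (p * c)))"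
    if "0 < p" "c \<noteq> 0" for p l k c I :: real
    using that by (simp add: divide_simps power2_eq_square) (simp add: algebra_simps)
  have eq: "AE z in lborel. indicator {0<..} z * (cdf D z * - ln (cdf D z)) - h z *\<^sub>R (w (cdf D z) * H z) =
      indicator {0<..} z * (cdf D z * - ln (cdf D z)) * deriv mit z"
    using deriv
  proof eventually_elim
    case (elim z)
    show ?case
    proof (cases "0 < z")
      \<comment> \<open>Here \<open>F = 0\<close>, and \<open>w 0 = 0\<close> by division by zero,
        so both sides vanish.\<close>
      case False then show ?thesis by (simp add: zero w_def)
    next
      case True
      then have d: "deriv mit z = 1 - (- ln (cdf D z) * h z) / cdf D' z * mit z"
        using elim by (simp add: DERIV_imp_deriv)
      have F: "0 < cdf D z" "1 - ln (cdf D z) \<noteq> 0"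
        using pos[OF True] ln_cdf_nonpos[of z] by linarith+
      have w: "w (cdf D z) = (ln (cdf D z))\<^sup>2 / (cdf D z * (1 - ln (cdf D z))\<^sup>2)"
        using F by (simp add: w_def)
      show ?thesis
        using True alg[OF F] unfolding d w mit_def H_def[symmetric] cdf_step by simp
    qed
  qed
  have "has_bochner_integral lborel
      (\<lambda>z. indicator {0<..} z * (cdf D z * - ln (cdf D z)) * deriv mit z)
      ((LBINT x:{0<..}. cdf D x * - ln (cdf D x)) - (LBINT x:{0<..}. cdf D' x * v (cdf D x)))"
    by (rule has_bochner_integral_cong_AE[THEN iffD1, OF _ _ eq diff])
      (use borel_measurable_has_bochner_integral[OF diff] in simp_all)
  \<comment> \<open>The integral of \<open>F T\<close> occurs in both parts and cancels.\<close>
  then show ?thesis unfolding v_val by simp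
qed

text \<open>For \<open>x > 0\<close>, \<open>ln G = ln F + ln (1 + T)\<close>; elsewhere the factor
  \<open>G\<close> is 0.\<close>

lemma entropy_step:
  "set_integrable lborel {0<..} (\<lambda>x. cdf D' x * ln (cdf D' x))"
  "- (LBINT x:{0<..}. cdf D' x * ln (cdf D' x)) =
    (LBINT x:{0<..}. cdf D' x * - ln (cdf D x)) - (LBINT x:{0<..}. cdf D' x * ln (1 - ln (cdf D x)))"
proof -
  have *: "cdf D' x * ln (cdf D' x) = cdf D' x * ln (1 - ln (cdf D x)) - cdf D' x * - ln (cdf D x)" for x
  proof (cases "0 < x")
    case True
    have "0 < 1 - ln (cdf D x)" using ln_cdf_nonpos[of x] by linarith
    then have "ln (cdf D' x) = ln (cdf D x) + ln (1 - ln (cdf D x))"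
      using pos[OF True] unfolding cdf_step by (intro ln_mult_pos)
    then show ?thesis by (simp only:) (simp add: algebra_simps)
  qed (simp add: zero')
  show "set_integrable lborel {0<..} (\<lambda>x. cdf D' x * ln (cdf D' x))"
    unfolding * by (intro set_integral_diff(1) GT_integrable G_ln_integrable)
  show "- (LBINT x:{0<..}. cdf D' x * ln (cdf D' x)) =
    (LBINT x:{0<..}. cdf D' x * - ln (cdf D x)) - (LBINT x:{0<..}. cdf D' x * ln (1 - ln (cdf D x)))"
    unfolding * by (subst set_integral_diff(2)[OF G_ln_integrable GT_integrable]) simp
qed

end

end

section \<open>Induction along the recursion and assembly of the identity\<close>

theorem theorem9:
  fixes P :: "'a measure" and X :: "'a \<Rightarrow> real"
    and M :: "'b measure" and Xs :: "nat \<Rightarrow> 'b \<Rightarrow> real"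
    and f :: "nat \<Rightarrow> real \<Rightarrow> real" and n :: nat
  assumes "prob_space P"
    and X_density: "distributed P lborel X (\<lambda>x. ennreal (f 1 x))"
    and f_nonneg: "\<And>x. 0 \<le> f 1 x"
    and X_nonneg: "AE \<omega> in P. 0 \<le> X \<omega>"
    and X_cdf_pos: "\<And>t. 0 < t \<Longrightarrow> 0 < rv_cdf P X t"
    and "prob_space M"
    and Xs_rv: "\<And>k. 1 \<le> k \<Longrightarrow> Xs k \<in> borel_measurable M"
    and Xs_1: "distr M borel (Xs 1) = distr P borel X"
    and cdf_rec: "\<And>k t. 1 \<le> k \<Longrightarrow> 0 < t \<Longrightarrow>
          rv_cdf M (Xs (Suc k)) t = rv_cdf M (Xs k) t * (1 + neg_log_cdf M (Xs k) t)"
    and pdf_rec: "\<And>k t. 1 \<le> k \<Longrightarrow> 0 < t \<Longrightarrow>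
          f (Suc k) t = neg_log_cdf M (Xs k) t * f k t"
    and n: "1 \<le> n"
    and finite_mean: "integrable M (Xs n)"
  defines "\<tau> \<equiv> reversed_hazard_rate (f (Suc n)) (rv_cdf M (Xs (Suc n)))"
    and "\<mu> \<equiv> mean_inactivity_time M (Xs (Suc n))"
    and "fZ \<equiv> cdf_gap_density M (Xs n) (Xs (Suc n))"
  shows
    \<comment> \<open>\<open>fZ\<close> is a probability density, with the two stated expressions\<close>
    "(integrable M (Xs (Suc n))
      \<and> (\<integral>\<omega>. Xs (Suc n) \<omega> \<partial>M) < (\<integral>\<omega>. Xs n \<omega> \<partial>M)
      \<and> set_integrable lborel {0<..} (cumulative_entropy_integrand M (Xs n))
      \<and> 0 < cumulative_entropy M (Xs n)
      \<and> fZ \<in> borel_measurable borel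
      \<and> (\<forall>z. 0 \<le> fZ z)
      \<and> prob_space (density lborel (\<lambda>z. ennreal (fZ z)))
      \<and> (\<forall>z>0. fZ z = rv_cdf M (Xs n) z * neg_log_cdf M (Xs n) z / cumulative_entropy M (Xs n)))
     \<comment> \<open>the derivative of \<open>\<mu>\<close>: wherever \<open>f 1\<close> is the derivative of the distribution function
        of \<open>X\<close>, and in any case almost everywhere\<close>
     \<and> (\<forall>t>0. (rv_cdf P X has_real_derivative f 1 t) (at t) \<longrightarrow>
           (\<mu> has_real_derivative 1 - \<tau> t * \<mu> t) (at t))
     \<and> (AE t in lborel. 0 < t \<longrightarrow> (\<mu> has_real_derivative 1 - \<tau> t * \<mu> t) (at t))
     \<comment> \<open>the identity, all of whose terms are finite\<close>
     \<and> set_integrable lborel {0<..} (cumulative_entropy_integrand M (Xs (Suc n)))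
     \<and> integrable M (\<lambda>\<omega>. \<mu> (Xs n \<omega>))
     \<and> (\<forall>(N :: 'c measure) Z. prob_space N \<longrightarrow> distributed N lborel Z (\<lambda>z. ennreal (fZ z)) \<longrightarrow>
           integrable N (\<lambda>\<omega>. deriv \<mu> (Z \<omega>))
           \<and> cumulative_entropy M (Xs (Suc n)) =
               (\<integral>\<omega>. \<mu> (Xs n \<omega>) \<partial>M)
               - (\<integral>\<omega>. deriv \<mu> (Z \<omega>) \<partial>N) * cumulative_entropy M (Xs n))"
proof -
  interpret P: prob_space P by fact
  interpret M: prob_space M by fact
  define D where "D k = distr M borel (Xs k)" for k
  have cdf: "rv_cdf M (Xs k) = cdf (D k)" for k
    by (simp add: rv_cdf_def D_def)
  have cdf_P: "rv_cdf P X = cdf (D 1)"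
    by (simp add: rv_cdf_def D_def Xs_1[simplified])
  have RD: "real_distribution (D k)" if "1 \<le> k" for k
    unfolding D_def using Xs_rv[OF that] by (rule M.real_distribution_distr)
  have X_rv[measurable]: "X \<in> borel_measurable P"
    using distributed_measurable[OF X_density] by simp
  have f_borel[measurable]: "f 1 \<in> borel_measurable borel"
  proof -
    \<comment> \<open>\<open>distributed\<close> provides measurability only after
      \<open>ennreal\<close>; nonnegativity of \<open>f 1\<close> lets \<open>enn2real\<close> undo
      it.\<close>
    have "(\<lambda>x. enn2real (ennreal (f 1 x))) \<in> borel_measurable borel"
      using distributed_borel_measurable[OF X_density] by measurable
    then show ?thesis by (simp add: f_nonneg[simplified])
  qed
  note [measurable] = f_borel[unfolded One_nat_def]
  have D1: "D 1 = density lborel (\<lambda>x. ennreal (f 1 x))"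
    unfolding D_def Xs_1 using distributed_distr_eq_density[OF X_density]
    by (simp cong: distr_cong)
  interpret D1: real_distribution "D 1" by (rule RD) simp
  note [simp] = D1.events_eq_borel[unfolded One_nat_def] D1.space_eq_univ[unfolded One_nat_def]
  have f_int: "integrable lborel (f 1)"
  proof (rule integrableI_nonneg)
    have "(\<integral>\<^sup>+x. ennreal (f 1 x) \<partial>lborel) = emeasure (D 1) UNIV"
      unfolding D1 by (subst emeasure_density) auto
    also have "\<dots> < \<infinity>" using D1.emeasure_finite[of UNIV] by (simp only: less_top infinity_ennreal_def)
    finally show "(\<integral>\<^sup>+x. ennreal (f 1 x) \<partial>lborel) < \<infinity>" .
  qed (use f_nonneg in auto)
  have cdf_D1: "cdf (D 1) t = (LBINT x:{..t}. f 1 x)" for t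
  proof -
    have "emeasure (D 1) {..t} = (\<integral>\<^sup>+x. ennreal (indicator {..t} x *\<^sub>R f 1 x) \<partial>lborel)"
      unfolding D1 by (subst emeasure_density) (auto intro!: nn_integral_cong split: split_indicator)
    also have "\<dots> = ennreal (LBINT x:{..t}. f 1 x)"
      unfolding set_lebesgue_integral_def using f_nonneg
      by (intro nn_integral_eq_integral integrable_mult_indicator f_int) auto
    finally show ?thesis
      using f_nonneg by (simp add: cdf_def measure_def set_lebesgue_integral_def)
  qed
  have D1_singleton: "emeasure (D 1) {x} = 0" for x
    unfolding D1 by (subst emeasure_density) (auto intro!: nn_integral_null_set)
  \<comment> \<open>The density recursion is given only for \<open>t > 0\<close>, and
    \<open>f 1\<close> may be nonzero on a null set of other points. \<open>h k\<close> is the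
    version supported on the positive half-line.\<close>
  define h where "h k t = (if 0 < t then f k t else 0)" for k t
  have D1_pos: "AE t in D 1. 0 < t"
  proof -
    have "AE t in D 1. 0 \<le> t"
      unfolding D_def Xs_1 using X_nonneg by (subst AE_distr_iff) auto
    moreover have "AE t in D 1. t \<noteq> 0"
      using D1_singleton[of 0] AE_not_in[of "{0}" "D 1"] by (simp add: null_sets_def)
    ultimately show ?thesis by eventually_elim simp
  qed
  \<comment> \<open>Besides the locale assumptions and a density, the invariant carries
    differentiability: a point where the first CDF has derivative \<open>f 1\<close> is good for
    every \<open>k\<close>, so one exceptional null set serves the whole sequence.\<close>
  have inv: "continuous_on UNIV (cdf (D k)) \<and> (\<forall>x\<le>0. cdf (D k) x = 0) \<and> (\<forall>x>0. 0 < cdf (D k) x)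
      \<and> h k \<in> borel_measurable borel \<and> (\<forall>t. 0 \<le> h k t) \<and> D k = density lborel (\<lambda>t. ennreal (h k t))
      \<and> (\<forall>t>0. (cdf (D 1) has_real_derivative f 1 t) (at t) \<longrightarrow> (cdf (D k) has_real_derivative f k t) (at t))"
    if "1 \<le> k" for k
    using that
  proof (induction k rule: dec_induct)
    case base
    have "isCont (cdf (D 1)) x" for x
      using D1_singleton[of x] by (subst D1.isCont_cdf) (simp add: measure_def)
    then have "continuous_on UNIV (cdf (D 1))" by (simp add: continuous_at_imp_continuous_on)
    moreover have "cdf (D 1) x = 0" if "x \<le> 0" for x
    proof -
      have "AE t in D 1. t \<notin> {..x}" using D1_pos by eventually_elim (use that in auto)
      then have "{..x} \<in> null_sets (D 1)" by (subst (asm) AE_iff_null_sets[symmetric]) auto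
      then show ?thesis by (simp add: cdf_def null_sets_def measure_def)
    qed
    moreover have "0 < cdf (D 1) x" if "0 < x" for x
      using X_cdf_pos[OF that] by (simp only: cdf_P)
    moreover have "h 1 \<in> borel_measurable borel" unfolding h_def by measurable
    moreover have "0 \<le> h 1 t" for t using f_nonneg by (simp add: h_def)
    moreover have "D 1 = density lborel (\<lambda>t. ennreal (h 1 t))"
    proof -
      have "AE t in lborel. 0 < ennreal (f 1 t) \<longrightarrow> 0 < t"
        using D1_pos unfolding D1 by (subst (asm) AE_density) auto
      then have "AE t in lborel. ennreal (f 1 t) = ennreal (h 1 t)"
        by eventually_elim (use f_nonneg in \<open>auto simp: h_def not_less le_less\<close>)
      then show ?thesis
        unfolding D1 by (intro density_cong) (auto simp: h_def)
    qed
    ultimately show ?case by blast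
  next
    case (step k)
    interpret L: cdf_log_step "D k" "D (Suc k)"
      using step RD[of k] RD[of "Suc k"] cdf_rec[of k]
      by (intro cdf_log_step.intro cdf_log_step_axioms.intro) (auto simp: cdf neg_log_cdf_def)
    have h_Suc: "h (Suc k) t = h k t * - ln (cdf (D k) t)" for t
      using pdf_rec[of k t] step.hyps by (simp add: h_def cdf neg_log_cdf_def)
    have [measurable]: "h k \<in> borel_measurable borel" using step.IH by simp
    have "h (Suc k) \<in> borel_measurable borel" unfolding h_Suc[abs_def] by measurable
    moreover have "0 \<le> h (Suc k) t" for t
      using step.IH L.ln_cdf_nonpos[of t] unfolding h_Suc by (intro mult_nonneg_nonneg) auto
    moreover have "D (Suc k) = density lborel (\<lambda>t. ennreal (h (Suc k) t))"
    proof -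
      have "D (Suc k) = density (density lborel (\<lambda>t. ennreal (h k t))) (\<lambda>t. ennreal (- ln (cdf (D k) t)))"
        using L.step_density step.IH by metis
      also have "\<dots> = density lborel (\<lambda>t. ennreal (h k t) * ennreal (- ln (cdf (D k) t)))"
        by (subst density_density_eq) auto
      also have "\<dots> = density lborel (\<lambda>t. ennreal (h (Suc k) t))"
        using step.IH L.ln_cdf_nonpos by (simp add: h_Suc ennreal_mult[symmetric])
      finally show ?thesis .
    qed
    moreover have "(cdf (D (Suc k)) has_real_derivative f (Suc k) t) (at t)"
      if "0 < t" "(cdf (D 1) has_real_derivative f 1 t) (at t)" for t
    proof -
      have "(cdf (D k) has_real_derivative f k t) (at t)" using step.IH that by blast
      from L.cdf_step_has_derivative[OF that(1) this] show ?thesis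
        using pdf_rec[of k t] step.hyps that(1) by (simp add: cdf neg_log_cdf_def)
    qed
    ultimately show ?case using L.cont' L.zero' L.pos' by blast
  qed
  interpret L: cdf_log_step "D n" "D (Suc n)"
    using inv[OF n] RD[of n] RD[of "Suc n"] cdf_rec[of n] n
    by (intro cdf_log_step.intro cdf_log_step_axioms.intro) (auto simp: cdf neg_log_cdf_def)
  have [measurable]: "Xs n \<in> borel_measurable M" "Xs (Suc n) \<in> borel_measurable M"
    using Xs_rv n by auto
  have mean: "integrable (D n) (\<lambda>x. x)"
    using finite_mean unfolding D_def by (subst integrable_distr_eq) auto
  define CE where "CE = (LBINT x:{0<..}. cdf (D n) x * - ln (cdf (D n) x))"
  have CE: "cumulative_entropy M (Xs n) = CE"
    by (simp add: CE_def cumulative_entropy_def cumulative_entropy_integrand_def cdf set_lebesgue_integral_def)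
  have CE_pos: "0 < CE" unfolding CE_def using mean by (rule L.entropy_pos)
  have int_Suc: "integrable M (Xs (Suc n))"
    using L.step_integrable[OF mean] unfolding D_def by (subst (asm) integrable_distr_eq) auto
  have E: "(\<integral>\<omega>. Xs k \<omega> \<partial>M) = (\<integral>x. x \<partial>D k)" if "Xs k \<in> borel_measurable M" for k
    unfolding D_def using that by (subst integral_distr) auto
  have gap: "(\<integral>\<omega>. Xs n \<omega> \<partial>M) - (\<integral>\<omega>. Xs (Suc n) \<omega> \<partial>M) = CE"
    using L.means_gap[OF mean] by (simp add: E CE_def)
  \<comment> \<open>The denominator is \<open>CE\<close> by \<open>gap\<close> and the numerator is
    \<open>G - F = F T\<close>, which gives the second form of the density.\<close>
  have fZ_eq: "fZ z = indicator {0<..} z * (cdf (D n) z * - ln (cdf (D n) z)) / CE" for z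
    unfolding fZ_def cdf_gap_density_def gap cdf by (simp add: L.cdf_step algebra_simps)
  have fZ_borel[measurable]: "fZ \<in> borel_measurable borel" unfolding fZ_eq[abs_def] by measurable
  have fZ_nonneg: "0 \<le> fZ z" for z
  proof -
    have "0 \<le> cdf (D n) z * - ln (cdf (D n) z)"
      using L.ln_cdf_nonpos[of z] L.D.cdf_nonneg[of z] by (intro mult_nonneg_nonneg) auto
    then have "0 \<le> indicator {0<..} z * (cdf (D n) z * - ln (cdf (D n) z))"
      by (rule mult_nonneg_nonneg[rotated]) simp
    then show ?thesis unfolding fZ_eq using CE_pos by (intro divide_nonneg_nonneg) simp_all
  qed
  have fZ_integral: "has_bochner_integral lborel fZ 1"
  proof -
    have "has_bochner_integral lborel (\<lambda>z. indicator {0<..} z * (cdf (D n) z * - ln (cdf (D n) z))) CE"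
      using L.FT_integrable[OF mean]
      by (simp add: has_bochner_integral_iff set_integrable_def set_lebesgue_integral_def CE_def)
    from has_bochner_integral_divide_zero[OF this, of CE] CE_pos show ?thesis
      unfolding fZ_eq[abs_def] by simp
  qed
  have fZ_prob: "prob_space (density lborel (\<lambda>z. ennreal (fZ z)))"
  proof (rule prob_spaceI)
    show "emeasure (density lborel (\<lambda>z. ennreal (fZ z))) (space (density lborel (\<lambda>z. ennreal (fZ z)))) = 1"
      using fZ_integral fZ_nonneg
      by (subst emeasure_density) (auto simp: nn_integral_eq_integral has_bochner_integral_iff)
  qed
  have \<mu>: "\<mu> = L.mit"
    unfolding \<mu>_def L.mit_def
    by (rule ext, subst mean_inactivity_time_eq) (simp_all add: M.prob_space_axioms cdf L.zero')
  have \<mu>_deriv: "(\<mu> has_real_derivative 1 - \<tau> t * \<mu> t) (at t)"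
    if "0 < t" "(rv_cdf P X has_real_derivative f 1 t) (at t)" for t
  proof -
    have "(cdf (D n) has_real_derivative f n t) (at t)"
      using inv[OF n] that unfolding cdf_P by blast
    from L.mit_has_derivative[OF that(1) this] show ?thesis
      using pdf_rec[OF n that(1)] by (simp add: \<mu> \<tau>_def reversed_hazard_rate_def cdf neg_log_cdf_def)
  qed
  have \<mu>_deriv_AE: "AE t in lborel. 0 < t \<longrightarrow> (\<mu> has_real_derivative 1 - \<tau> t * \<mu> t) (at t)"
    \<comment> \<open>Lebesgue differentiation is applied to \<open>f 1\<close> alone; the invariant
      passes it on to index \<open>n\<close>.\<close>
    using lebesgue_differentiation[OF f_int]
    unfolding cdf_D1[symmetric] cdf_P[symmetric] by eventually_elim (blast intro: \<mu>_deriv)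
  define A where "A = (LBINT x:{0<..}. cdf (D (Suc n)) x * ln (1 - ln (cdf (D n) x)))"
  define B where "B = (LBINT x:{0<..}. cdf (D (Suc n)) x * - ln (cdf (D n) x))"
  have \<mu>_mean: "has_bochner_integral (D n) \<mu> A"
    unfolding \<mu> A_def using mean by (rule L.mit_expectation)
  have [measurable]: "\<mu> \<in> borel_measurable borel"
    unfolding \<mu> using L.mit_continuous by (rule borel_measurable_continuous_onI)
  have \<mu>_int: "integrable M (\<lambda>\<omega>. \<mu> (Xs n \<omega>))" "(\<integral>\<omega>. \<mu> (Xs n \<omega>) \<partial>M) = A"
    using \<mu>_mean unfolding D_def has_bochner_integral_iff
    by (auto simp: integrable_distr_eq integral_distr)
  have CE_Suc: "set_integrable lborel {0<..} (cumulative_entropy_integrand M (Xs (Suc n)))"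
    "cumulative_entropy M (Xs (Suc n)) = B - A"
    using L.entropy_step[OF mean]
    by (simp_all add: cumulative_entropy_def cumulative_entropy_integrand_def[abs_def] cdf A_def B_def)
  have [measurable]: "deriv \<mu> \<in> borel_measurable borel"
    unfolding \<mu> using L.mit_continuous by (rule borel_measurable_deriv)
  have "has_bochner_integral lborel
      (\<lambda>z. indicator {0<..} z * (cdf (D n) z * - ln (cdf (D n) z)) * deriv \<mu> z) (2 * A - B)"
    unfolding \<mu> A_def B_def
  proof (rule L.deriv_mit_gap[OF mean])
    show "AE t in lborel. 0 < t \<longrightarrow> (L.mit has_real_derivative
        1 - (- ln (cdf (D n) t) * h n t) / cdf (D (Suc n)) t * L.mit t) (at t)"
      using \<mu>_deriv_AE pdf_rec[OF n]
      by (simp add: \<mu> \<tau>_def reversed_hazard_rate_def neg_log_cdf_def cdf h_def cong: imp_cong)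
  qed (use inv[OF n] in auto)
  from has_bochner_integral_divide_zero[OF this, of CE]
  have fZ_deriv: "has_bochner_integral lborel (\<lambda>z. fZ z * deriv \<mu> z) ((2 * A - B) / CE)"
    by (simp add: fZ_eq[abs_def])
  have final: "integrable N (\<lambda>\<omega>. deriv \<mu> (Z \<omega>)) \<and> cumulative_entropy M (Xs (Suc n)) =
      (\<integral>\<omega>. \<mu> (Xs n \<omega>) \<partial>M) - (\<integral>\<omega>. deriv \<mu> (Z \<omega>) \<partial>N) * cumulative_entropy M (Xs n)"
    if Z: "distributed N lborel Z (\<lambda>z. ennreal (fZ z))" for N :: "'c measure" and Z
  proof -
    have "integrable N (\<lambda>\<omega>. deriv \<mu> (Z \<omega>))"
      using fZ_deriv distributed_integrable[OF Z, of "deriv \<mu>"] fZ_nonneg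
      by (simp add: has_bochner_integral_iff)
    moreover have "(\<integral>\<omega>. deriv \<mu> (Z \<omega>) \<partial>N) = (2 * A - B) / CE"
      using fZ_deriv distributed_integral[OF Z, of "deriv \<mu>"] fZ_nonneg
      by (simp add: has_bochner_integral_iff)
    \<comment> \<open>\<open>B - A = A - (2 * A - B)\<close>, and the positive factor
      \<open>CE\<close> cancels against the denominator of \<open>fZ\<close>.\<close>
    ultimately show ?thesis
      using CE_pos by (simp add: CE CE_Suc \<mu>_int)
  qed
  have ent_int: "set_integrable lborel {0<..} (cumulative_entropy_integrand M (Xs n))"
    using L.FT_integrable[OF mean]
    by (simp add: cumulative_entropy_integrand_def[abs_def] cdf set_integrable_def)
  have fZ_alt: "fZ z = rv_cdf M (Xs n) z * neg_log_cdf M (Xs n) z / cumulative_entropy M (Xs n)"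
    if "0 < z" for z
    using that by (simp add: fZ_eq CE cdf neg_log_cdf_def)
  show ?thesis
    using int_Suc gap CE_pos ent_int fZ_borel fZ_nonneg fZ_prob fZ_alt \<mu>_deriv \<mu>_deriv_AE CE_Suc(1) \<mu>_int(1) final
    unfolding CE by auto
qed

end
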